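(* Let $q\in[0,1]$, let $R_q>0$ and $\omega>0$ be such that $\Theta^*\in\mathbb{B}_q(R_q)\cap\Omega$, and let $\lambda>0$. Let $\mathcal{P}_\lambda$ be the spectral regularizer built from a univariate function $p_\lambda$ satisfying conditions (i)–(v) of the context (with constant $\mu\ge 0$). Suppose that the loss $\mathcal{L}_N$ satisfies, for some $\alpha_1>0$ and $\tau_1>0$ with $\alpha_1>\mu$, $$\langle \nabla\mathcal{L}_N(\Theta^*+\Delta)-\nabla\mathcal{L}_N(\Theta^* ),\Delta\rangle\ \ge\ \alpha_1\|\Delta\|_F^2-\tau_1\|\Delta\|_*^2\qquad\text{for all }\Delta\in\mathbb{R}^{d_1\times d_2}.$$ Assume that $(\lambda,\omega)$ satisfy $$\lambda\ \ge\ 2\max\{\|\nabla\mathcal{L}_N(\Theta^* )\|_{op},\,4\omega\tau_1\}.$$ Let $\tilde\Theta\in\Omega$ be a stationary point of the problem $\min_{\Theta\in\Omega}\{\mathcal{L}_N(\Theta)+\mathcal{P}_\lambda(\Theta)\}$. Then $$\|\tilde\Theta-\Theta^*\|_F^2\le 9R_q\left(\frac{\lambda}{\alpha_1-\mu}\right)^{2-q}\quad\text{and}\quad \|\tilde\Theta-\Theta^*\|_*\le(24\sqrt2+8)R_q\left(\frac{\lambda}{\alpha_1-\mu}\right)^{1-q}.$$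
   Context: Let $d_1,d_2\ge1$ and $d=\min\{d_1,d_2\}$. For $\Theta\in\mathbb{R}^{d_1\times d_2}$ let $\sigma_1(\Theta)\ge\dots\ge\sigma_d(\Theta)\ge0$ be its singular values, $\|\Theta\|_*=\sum_j\sigma_j(\Theta)$, $\|\Theta\|_{op}=\sigma_1(\Theta)$, $\|\Theta\|_F=(\sum_j\sigma_j(\Theta)^2)^{1/2}$, and $\langle A,B\rangle=\mathrm{trace}(A^\top B)$. For $q\in[0,1]$ and $R_q>0$, $\mathbb{B}_q(R_q)=\{\Theta\in\mathbb{R}^{d_1\times d_2}:\sum_{i=1}^d|\sigma_i(\Theta)|^q\le R_q\}$, where for $q=0$ the sum is the number of nonzero singular values (the rank). The feasible region is $\Omega=\{\Theta\in\mathbb{R}^{d_1\times d_2}:\|\Theta\|_*\le\omega\}$. The matrix $\Theta^*\in\mathbb{R}^{d_1\times d_2}$ is the fixed (true) parameter. The loss $\mathcal{L}_N:\mathbb{R}^{d_1\times d_2}\to\mathbb{R}_+$ is a differentiable, not necessarily convex, function. Regularizer: $\mathcal{P}_\lambda(\Theta)=\sum_{j=1}^d p_\lambda(\sigma_j(\Theta))$ with $p_\lambda:\mathbb{R}\to\mathbb{R}$. Write $p_\lambda(t)=q_\lambda(t)+\lambda|t|$ with $q_\lambda$ concave, and $\mathcal{Q}_\lambda(\Theta)=\sum_{j=1}^d q_\lambda(\sigma_j(\Theta))$, so $\mathcal{P}_\lambda=\mathcal{Q}_\lambda+\lambda\|\cdot\|_*$; $\mathcal{Q}_\lambda$ is the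 differentiable part. Conditions on $p_\lambda$: (i) $p_\lambda(0)=0$ and $p_\lambda(t)=p_\lambda(-t)$ for all $t\in\mathbb{R}$; (ii) for $t>0$, $t\mapsto p_\lambda(t)/t$ is nonincreasing; (iii) $p_\lambda$ is differentiable for all $t\ne0$ and subdifferentiable at $t=0$, with $\lim_{t\to0^+}p_\lambda'(t)=\lambda$; (iv) on $[0,\infty)$, $p_\lambda$ is nondecreasing and concave; (v) there is a constant $\mu\ge0$ such that $q_\lambda'(t)-q_\lambda'(t')\ge-\mu(t-t')$ for all $t>t'$. Stationary point: $\tilde\Theta\in\Omega$ is a stationary point if $\langle\nabla\mathcal{L}_N(\tilde\Theta)+\nabla\mathcal{P}_\lambda(\tilde\Theta),\Theta-\tilde\Theta\rangle\ge0$ for all $\Theta\in\Omega$, where $\nabla\mathcal{P}_\lambda(\tilde\Theta)$ stands for $\nabla\mathcal{Q}_\lambda(\tilde\Theta)+\lambda\tilde G$ for some subgradient $\tilde G\in\partial\|\tilde\Theta\|_*$ of the nuclear norm at $\tilde\Theta$. *)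

theory Defs
  imports "HOL-Analysis.Analysis" "HOL-Computational_Algebra.Computational_Algebra"
begin

text \<open>
  A matrix with \<open>d\<^sub>1\<close> rows and \<open>d\<^sub>2\<close> columns has type \<open>real ^ 'n ^ 'm\<close> with
  \<open>d\<^sub>1 = CARD('m)\<close> and \<open>d\<^sub>2 = CARD('n)\<close>.
\<close>

definition mat_inner :: "real ^ 'n ^ 'm \<Rightarrow> real ^ 'n ^ 'm \<Rightarrow> real"
  where "mat_inner A B = trace (transpose A ** B)"

text \<open>
  The library's inner product on matrices is this trace inner product, so \<open>GDERIV\<close>
  is the gradient with respect to it.
\<close>

lemma mat_inner_eq_inner: "mat_inner A B = A \<bullet> B"
  unfolding mat_inner_def trace_def matrix_matrix_mult_def transpose_def inner_vec_def
  by (simp, rule sum.swap)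

definition charpoly :: "real ^ 'n ^ 'n \<Rightarrow> real poly"
  where "charpoly A = det (\<chi> i j. (if i = j then [:0, 1:] else 0) - [:A $ i $ j:])"

lemma poly_charpoly: "poly (charpoly A) x = det (mat x - A)"
  unfolding charpoly_def det_def mat_def
  by (auto simp: poly_sum poly_prod intro!: sum.cong prod.cong)

definition min_dim :: "real ^ 'n ^ 'm \<Rightarrow> nat"
  where "min_dim A = min CARD('m) CARD('n)"

text \<open>
  The eigenvalues of \<open>A\<^sup>T A\<close>, with multiplicity, are the roots of its characteristic
  polynomial.  There are \<open>d\<^sub>2\<close> of them, all real and nonnegative; at most
  \<open>min d\<^sub>1 d\<^sub>2\<close> are nonzero, and the square roots of the largest \<open>min d\<^sub>1 d\<^sub>2\<close> are the
  singular values, in nonincreasing order.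
\<close>

definition singular_values :: "real ^ 'n ^ 'm \<Rightarrow> real list"
  where "singular_values A =
    take (min_dim A)
      (rev (sorted_list_of_multiset (image_mset sqrt (proots (charpoly (transpose A ** A))))))"

text \<open>The index of a singular value runs over \<open>1, \<dots>, min_dim A\<close>.\<close>

definition sv :: "real ^ 'n ^ 'm \<Rightarrow> nat \<Rightarrow> real"
  where "sv A j = singular_values A ! (j - 1)"

definition spectral_fun :: "(real \<Rightarrow> real) \<Rightarrow> real ^ 'n ^ 'm \<Rightarrow> real"
  where "spectral_fun f A = (\<Sum>j = 1..min_dim A. f (sv A j))"

definition nuclear_norm :: "real ^ 'n ^ 'm \<Rightarrow> real"
  where "nuclear_norm A = (\<Sum>j = 1..min_dim A. sv A j)"

definition op_norm :: "real ^ 'n ^ 'm \<Rightarrow> real"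
  where "op_norm A = sv A 1"

definition frob_norm :: "real ^ 'n ^ 'm \<Rightarrow> real"
  where "frob_norm A = sqrt (\<Sum>j = 1..min_dim A. (sv A j)\<^sup>2)"

definition schatten_ball :: "real \<Rightarrow> real \<Rightarrow> (real ^ 'n ^ 'm) set"
  where "schatten_ball q R =
    {A. (if q = 0 then real (card {j \<in> {1..min_dim A}. sv A j \<noteq> 0})
         else (\<Sum>j = 1..min_dim A. \<bar>sv A j\<bar> powr q)) \<le> R}"

definition nuclear_ball :: "real \<Rightarrow> (real ^ 'n ^ 'm) set"
  where "nuclear_ball \<omega> = {A. nuclear_norm A \<le> \<omega>}"

definition nuclear_subdifferential :: "real ^ 'n ^ 'm \<Rightarrow> (real ^ 'n ^ 'm) set"
  where "nuclear_subdifferential A =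
    {G. \<forall>B. nuclear_norm A + mat_inner G (B - A) \<le> nuclear_norm B}"

definition smooth_part :: "real \<Rightarrow> (real \<Rightarrow> real) \<Rightarrow> real \<Rightarrow> real"
  where "smooth_part lam p t = p t - lam * \<bar>t\<bar>"

text \<open>
  The derivative of the smooth part is used at every real argument, so differentiability on
  the whole line, including at 0, is part of the conditions.
\<close>

definition regularizer_conditions :: "real \<Rightarrow> real \<Rightarrow> (real \<Rightarrow> real) \<Rightarrow> bool"
  where "regularizer_conditions lam \<mu> p \<longleftrightarrow>
    p 0 = 0 \<and> (\<forall>t. p t = p (- t)) \<and>
    antimono_on {0<..} (\<lambda>t. p t / t) \<and>
    (\<forall>t. t \<noteq> 0 \<longrightarrow> p differentiable (at t)) \<and>
    (\<exists>g. \<forall>t. p 0 + g * t \<le> p t) \<and>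
    (deriv p \<longlongrightarrow> lam) (at_right 0) \<and>
    mono_on {0..} p \<and> concave_on {0..} p \<and>
    concave_on UNIV (smooth_part lam p) \<and>
    (\<forall>t. smooth_part lam p differentiable (at t)) \<and>
    0 \<le> \<mu> \<and>
    (\<forall>t t'. t' < t \<longrightarrow>
      deriv (smooth_part lam p) t - deriv (smooth_part lam p) t' \<ge> - \<mu> * (t - t'))"

text \<open>
  The regularizer is \<open>spectral_fun p\<close>.  Since singular values are nonnegative, it equals
  \<open>spectral_fun (smooth_part lam p) + lam * nuclear_norm\<close>, whose first summand is
  differentiable under the conditions above; its generalized gradients at \<open>A\<close> are:
\<close>

definition regularizer_gradients ::
    "real \<Rightarrow> (real \<Rightarrow> real) \<Rightarrow> real ^ 'n ^ 'm \<Rightarrow> (real ^ 'n ^ 'm) set"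
  where "regularizer_gradients lam p A =
    {D + lam *\<^sub>R G | D G.
      GDERIV (spectral_fun (smooth_part lam p)) A :> D \<and> G \<in> nuclear_subdifferential A}"

definition stationary_point ::
    "(real ^ 'n ^ 'm \<Rightarrow> real) \<Rightarrow> real \<Rightarrow> (real \<Rightarrow> real) \<Rightarrow> real \<Rightarrow> real ^ 'n ^ 'm \<Rightarrow> bool"
  where "stationary_point L lam p \<omega> A \<longleftrightarrow>
    A \<in> nuclear_ball \<omega> \<and>
    (\<exists>D. GDERIV L A :> D \<and>
      (\<exists>H \<in> regularizer_gradients lam p A.
        \<forall>B \<in> nuclear_ball \<omega>. mat_inner (D + H) (B - A) \<ge> 0))"

end

theory Submission
  imports Defs
begin

text \<open>
  Convexity of \<open>q\<^sub>\<lambda> + \<mu> t\<^sup>2 / 2\<close> lifts to spectral functions: they have an explicit subgradient at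
  every matrix.  Hence the stationarity condition bounds \<open>(\<alpha> - \<mu>/2) \<parallel>\<Delta>\<parallel>\<^sub>F\<^sup>2\<close>, where
  \<open>\<Delta> = \<Theta>t - \<Theta>s\<close>, by \<open>P(\<Theta>s) - P(\<Theta>t) + (3/4) \<lambda> \<parallel>\<Delta>\<parallel>\<^sub>*\<close>; the condition on \<open>\<lambda>\<close> absorbs the noise and
  \<open>\<tau> \<parallel>\<Delta>\<parallel>\<^sub>*\<^sup>2 \<le> 2 \<omega> \<tau> \<parallel>\<Delta>\<parallel>\<^sub>*\<close>.  The same subgradients, applied along a finely subdivided segment,
  show that \<open>P\<close> is \<open>\<lambda>\<close>-Lipschitz for the nuclear norm, which replaces Rotfel'd's inequality.

  Truncate \<open>\<Theta>s = A + T\<close> at the level \<open>\<eta> = \<lambda> / (\<alpha> - \<mu>)\<close>, let \<open>r\<close> be the rank of \<open>A\<close>, and split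
  \<open>\<Delta> = M1 + M2\<close>, where \<open>M2\<close> is orthogonal to the row and column spaces of \<open>A\<close>.  Then
  \<open>P(A + M2) = P(A) + P(M2)\<close>, \<open>P(M2) \<ge> \<lambda> \<parallel>M2\<parallel>\<^sub>* - \<mu>/2 \<parallel>M2\<parallel>\<^sub>F\<^sup>2\<close> and
  \<open>\<parallel>M1\<parallel>\<^sub>* \<le> sqrt (2 r) \<parallel>\<Delta>\<parallel>\<^sub>F\<close>, so
  \<open>(\<alpha> - \<mu>) \<parallel>\<Delta>\<parallel>\<^sub>F\<^sup>2 + (\<lambda>/4) \<parallel>M2\<parallel>\<^sub>* \<le> (7/4) \<lambda> sqrt (2 r) \<parallel>\<Delta>\<parallel>\<^sub>F + 2 \<lambda> \<parallel>T\<parallel>\<^sub>*\<close>.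
  Membership in the Schatten ball gives \<open>r \<eta>\<^sup>q + \<parallel>T\<parallel>\<^sub>* \<eta>\<^sup>q\<^sup>-\<^sup>1 \<le> R\<close>; keeping the two parts of this
  budget together is what makes the constant 9 attainable.
\<close>

section \<open>Orthonormal families and rank-one matrices\<close>

definition outer :: "real ^ 'm \<Rightarrow> real ^ 'n \<Rightarrow> real ^ 'n ^ 'm"
  where "outer u v = (\<chi> i j. u $ i * v $ j)"

definition orthonormal_on :: "'i set \<Rightarrow> ('i \<Rightarrow> 'a::real_inner) \<Rightarrow> bool"
  where "orthonormal_on I u \<longleftrightarrow> (\<forall>i\<in>I. \<forall>j\<in>I. u i \<bullet> u j = (if i = j then 1 else 0))"

text \<open>The index type, the order and the number of terms are left free and zero values are
  allowed, so that restricting the index set, or joining two mutually orthogonal families, gives a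
  decomposition again.\<close>

definition svd_on ::
    "'i set \<Rightarrow> ('i \<Rightarrow> real) \<Rightarrow> ('i \<Rightarrow> real ^ 'm) \<Rightarrow> ('i \<Rightarrow> real ^ 'n) \<Rightarrow> real ^ 'n ^ 'm \<Rightarrow> bool"
  where "svd_on I s u v A \<longleftrightarrow> finite I \<and> (\<forall>i\<in>I. 0 \<le> s i) \<and> orthonormal_on I u \<and>
    orthonormal_on I v \<and> A = (\<Sum>i\<in>I. s i *\<^sub>R outer (u i) (v i))"

lemma inner_outer_right: "A \<bullet> outer u v = u \<bullet> (A *v v)"
  unfolding outer_def inner_vec_def matrix_vector_mult_def
  by (simp add: sum_distrib_left mult.assoc mult.left_commute mult.commute)

lemma outer_mult_vec: "outer u v *v x = (v \<bullet> x) *\<^sub>R u"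
  unfolding outer_def inner_vec_def matrix_vector_mult_def
  by (simp add: vec_eq_iff sum_distrib_left mult_ac)

lemma inner_outer_outer: "outer u v \<bullet> outer x y = (u \<bullet> x) * (v \<bullet> y)"
  by (simp add: inner_outer_right outer_mult_vec inner_commute mult.commute)

lemma transpose_outer: "transpose (outer u v) = outer v u"
  by (simp add: transpose_def outer_def vec_eq_iff)

lemma transpose_sum: "transpose (sum f I) = (\<Sum>i\<in>I. transpose (f i))"
  by (induction I rule: infinite_finite_induct) (auto simp: transpose_def vec_eq_iff)

lemma transpose_scaleR: "transpose (c *\<^sub>R (A :: real ^ 'n ^ 'm)) = c *\<^sub>R transpose A"
  by (simp add: transpose_def vec_eq_iff)

lemma transpose_diff: "transpose (A - B :: real ^ 'n ^ 'm) = transpose A - transpose B"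
  by (simp add: transpose_def vec_eq_iff)

lemma matrix_sum_mult_vec: "sum f I *v (x :: real ^ 'n) = (\<Sum>i\<in>I. f i *v x)"
  by (induction I rule: infinite_finite_induct) (auto simp: matrix_vector_mult_add_rdistrib)

lemma inner_sum_outer: "(\<Sum>i\<in>I. s i *\<^sub>R outer (u i) (v i)) \<bullet> B = (\<Sum>i\<in>I. s i * (u i \<bullet> (B *v v i)))"
  by (simp add: inner_sum_left inner_commute[of "outer _ _"] inner_outer_right)

lemma sum_outer_mult_vec:
  "(\<Sum>i\<in>I. s i *\<^sub>R outer (u i) (v i)) *v x = (\<Sum>i\<in>I. (s i * (v i \<bullet> x)) *\<^sub>R u i)"
  by (simp add: matrix_sum_mult_vec scaleR_matrix_vector_assoc[symmetric] outer_mult_vec)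

lemma transpose_sum_outer:
  "transpose (\<Sum>i\<in>I. s i *\<^sub>R outer (u i) (v i)) = (\<Sum>i\<in>I. s i *\<^sub>R outer (v i) (u i))"
  by (simp add: transpose_sum transpose_scaleR transpose_outer)

lemma orthonormal_onD:
  "orthonormal_on I u \<Longrightarrow> i \<in> I \<Longrightarrow> j \<in> I \<Longrightarrow> u i \<bullet> u j = (if i = j then 1 else 0)"
  by (simp add: orthonormal_on_def)

lemma orthonormal_on_subset: "orthonormal_on I u \<Longrightarrow> J \<subseteq> I \<Longrightarrow> orthonormal_on J u"
  unfolding orthonormal_on_def by blast

lemma orthonormal_on_inj: "orthonormal_on I u \<Longrightarrow> inj_on u I"
  by (rule inj_onI) (metis orthonormal_onD zero_neq_one)

lemma orthonormal_sum_inner: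
  assumes "finite I" "orthonormal_on I u" "j \<in> I"
  shows "(\<Sum>i\<in>I. c i *\<^sub>R u i) \<bullet> u j = c j"
proof -
  have "(\<Sum>i\<in>I. c i *\<^sub>R u i) \<bullet> u j = (\<Sum>i\<in>I. if i = j then c i else 0)"
    unfolding inner_sum_left using assms by (intro sum.cong) (auto simp: orthonormal_onD)
  then show ?thesis using assms by simp
qed

text \<open>The residual of \<open>x\<close> after projection onto the family has nonnegative
  squared norm.\<close>

lemma bessel:
  assumes "finite I" "orthonormal_on I u"
  shows "(\<Sum>i\<in>I. (u i \<bullet> x)\<^sup>2) \<le> x \<bullet> x"
proof -
  define y where "y = (\<Sum>i\<in>I. (u i \<bullet> x) *\<^sub>R u i)"
  have yy: "y \<bullet> y = (\<Sum>i\<in>I. (u i \<bullet> x)\<^sup>2)"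
  proof -
    have "y \<bullet> y = (\<Sum>i\<in>I. (u i \<bullet> x) * (y \<bullet> u i))"
      by (subst (2) y_def) (simp add: inner_sum_right)
    also have "\<dots> = (\<Sum>i\<in>I. (u i \<bullet> x)\<^sup>2)"
      unfolding y_def using assms
      by (intro sum.cong) (auto simp: orthonormal_sum_inner[OF assms] power2_eq_square)
    finally show ?thesis .
  qed
  have yx: "y \<bullet> x = (\<Sum>i\<in>I. (u i \<bullet> x)\<^sup>2)"
    unfolding y_def inner_sum_left by (simp add: power2_eq_square)
  have "0 \<le> (x - y) \<bullet> (x - y)" by simp
  also have "\<dots> = x \<bullet> x - 2 * (y \<bullet> x) + y \<bullet> y" by (simp add: inner_diff inner_commute)
  finally show ?thesis using yy yx by simp
qed

lemma orthonormal_on_card_le: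
  fixes u :: "'i \<Rightarrow> 'a::euclidean_space"
  assumes "orthonormal_on I u"
  shows "finite I \<and> card I \<le> DIM('a)"
proof -
  have "pairwise orthogonal (u ` I)" "0 \<notin> u ` I"
    using assms by (auto simp: pairwise_def orthogonal_def orthonormal_on_def) fastforce
  then have "independent (u ` I)" by (rule pairwise_orthogonal_independent)
  then have "finite (u ` I) \<and> card (u ` I) \<le> DIM('a)" by (simp add: independent_bound)
  with orthonormal_on_inj[OF assms] show ?thesis by (auto simp: card_image dest: finite_imageD)
qed

text \<open>An orthonormal set of greatest cardinality containing the family is a basis: otherwise a
  unit vector orthogonal to its span could be added. The basis is indexed by the coordinates, as the
  determinant computation requires, and \<iota> translates the indices.\<close>

lemma orthonormal_extension:
  fixes v :: "'i \<Rightarrow> real ^ 'n"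
  assumes "orthonormal_on I v"
  obtains e :: "'n \<Rightarrow> real ^ 'n" and \<iota> where
    "orthonormal_on UNIV e" "inj_on \<iota> I" "\<And>i. i \<in> I \<Longrightarrow> e (\<iota> i) = v i"
proof -
  define P where "P S \<longleftrightarrow> v ` I \<subseteq> S \<and> orthonormal_on S (\<lambda>x. x)" for S
  have bound: "finite S \<and> card S \<le> CARD('n)" if "P S" for S
    using orthonormal_on_card_le[of S "\<lambda>x. x"] that by (simp add: P_def)
  have "P (v ` I)"
    using assms by (auto simp: P_def orthonormal_on_def) (metis zero_neq_one)
  then obtain S where S: "P S" and max: "\<And>S'. P S' \<Longrightarrow> card S' \<le> card S"
    using ex_has_greatest_nat[of P "v ` I" card "Suc CARD('n)"] bound by (auto simp: less_Suc_eq_le)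
  have "card S = CARD('n)"
  proof (rule ccontr)
    assume "card S \<noteq> CARD('n)"
    then have "card S < CARD('n)" using bound[OF S] by simp
    moreover have "dim S \<le> card S" using bound[OF S] by (intro dim_le_card) (auto simp: span_base)
    ultimately have "dim S < DIM(real ^ 'n)" by simp
    then obtain x where x: "x \<noteq> 0" "\<And>y. y \<in> span S \<Longrightarrow> orthogonal x y"
      using orthogonal_to_subspace_exists by blast
    define z where "z = x /\<^sub>R norm x"
    have z: "z \<bullet> z = 1" "\<And>y. y \<in> S \<Longrightarrow> z \<bullet> y = 0"
      using x by (auto simp: z_def orthogonal_def span_base dot_square_norm)
    have "z \<notin> S" using z by fastforce
    have "P (insert z S)"
      using S z unfolding P_def orthonormal_on_def by (auto simp: inner_commute)
    then show False using max[of "insert z S"] \<open>z \<notin> S\<close> bound[OF S] by simp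
  qed
  then obtain e where e: "bij_betw e (UNIV :: 'n set) S"
    using bound[OF S] finite_same_card_bij[of "UNIV :: 'n set" S] by auto
  show ?thesis
  proof
    show "orthonormal_on UNIV e"
      using S e by (auto simp: P_def orthonormal_on_def bij_betw_def inj_on_def)
    have "v i \<in> range e" if "i \<in> I" for i using S e that by (auto simp: P_def bij_betw_def)
    then show *: "e (inv e (v i)) = v i" if "i \<in> I" for i using that f_inv_into_f by metis
    show "inj_on (\<lambda>i. inv e (v i)) I"
      using orthonormal_on_inj[OF assms] * by (auto simp: inj_on_def) metis
  qed
qed

section \<open>Singular values from a singular value decomposition\<close>

text \<open>With the eigenvectors as columns of an orthogonal matrix \<open>E\<close> one has
  \<open>M ** E = E ** \<Lambda>\<close>, and \<open>det E\<close> cancels.\<close>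

lemma det_eq_prod_eigenvalues:
  fixes M :: "real ^ 'n ^ 'n" and e :: "'n \<Rightarrow> real ^ 'n"
  assumes "orthonormal_on UNIV e" and eig: "\<And>j. M *v e j = d j *\<^sub>R e j"
  shows "det M = (\<Prod>j\<in>UNIV. d j)"
proof -
  define E :: "real ^ 'n ^ 'n" where "E = (\<chi> i j. e j $ i)"
  define \<Lambda> :: "real ^ 'n ^ 'n" where "\<Lambda> = (\<chi> i j. if i = j then d i else 0)"
  have "transpose E ** E = mat 1"
    using assms(1)
    by (simp add: vec_eq_iff E_def transpose_def matrix_matrix_mult_def mat_def
        orthonormal_on_def inner_vec_def)
  then have "det E * det E = 1" by (metis det_I det_mul det_transpose)
  then have E: "det E \<noteq> 0" by auto
  have "M ** E = E ** \<Lambda>"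
  proof -
    have "(M ** E) $ i $ j = (E ** \<Lambda>) $ i $ j" for i j
    proof -
      have "(M ** E) $ i $ j = (M *v e j) $ i"
        by (simp add: matrix_matrix_mult_def matrix_vector_mult_def E_def)
      also have "\<dots> = d j * e j $ i" by (simp add: eig)
      also have "\<dots> = (\<Sum>k\<in>UNIV. if k = j then e k $ i * d k else 0)" by simp
      also have "\<dots> = (\<Sum>k\<in>UNIV. e k $ i * (if k = j then d k else 0))" by (intro sum.cong) auto
      also have "\<dots> = (E ** \<Lambda>) $ i $ j"
        unfolding matrix_matrix_mult_def E_def \<Lambda>_def by simp
      finally show ?thesis .
    qed
    then show ?thesis by (simp add: vec_eq_iff)
  qed
  then have "det M * det E = det E * det \<Lambda>" by (metis det_mul)
  moreover have "det \<Lambda> = (\<Prod>j\<in>UNIV. d j)"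
    by (subst det_diagonal) (auto simp: \<Lambda>_def)
  ultimately show ?thesis using E by simp
qed

text \<open>The basis \<open>e\<close> also diagonalises \<open>mat x - M\<close>, with eigenvalues
  \<open>x - d j\<close>; real polynomials with the same values everywhere are equal.\<close>

lemma charpoly_eq_prod_eigenvalues:
  fixes M :: "real ^ 'n ^ 'n" and e :: "'n \<Rightarrow> real ^ 'n"
  assumes "orthonormal_on UNIV e" and "\<And>j. M *v e j = d j *\<^sub>R e j"
  shows "charpoly M = (\<Prod>j\<in>UNIV. [:- d j, 1:])"
proof -
  have "poly (charpoly M) x = poly (\<Prod>j\<in>UNIV. [:- d j, 1:]) x" for x
  proof -
    have "det (mat x - M) = (\<Prod>j\<in>UNIV. x - d j)"
    proof (rule det_eq_prod_eigenvalues[OF assms(1)])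
      have "mat x *v y = x *\<^sub>R y" for y :: "real ^ 'n"
        by (simp add: vec_eq_iff matrix_vector_mult_def mat_def if_distrib[of "\<lambda>a. a * _"] cong: if_cong)
      then show "(mat x - M) *v e j = (x - d j) *\<^sub>R e j" for j
        by (simp add: assms(2) matrix_vector_mult_diff_rdistrib scaleR_left_diff_distrib)
    qed
    then show ?thesis by (simp add: poly_charpoly poly_prod)
  qed
  then show ?thesis by (simp add: poly_eq_poly_eq_iff[symmetric] fun_eq_iff)
qed

lemma svd_on_mult_right:
  assumes "svd_on I s u v A" "i \<in> I"
  shows "A *v v i = s i *\<^sub>R u i"
proof -
  have "A *v v i = (\<Sum>k\<in>I. if k = i then s k *\<^sub>R u k else 0)"
    using assms unfolding svd_on_def
    by (auto simp: sum_outer_mult_vec orthonormal_onD simp del: sum.delta intro!: sum.cong)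
  then show ?thesis using assms by (simp add: svd_on_def)
qed

lemma svd_on_transpose:
  "svd_on I s u v A \<Longrightarrow> svd_on I s v u (transpose A)"
  unfolding svd_on_def by (simp add: transpose_sum_outer)

lemma svd_on_card_le:
  assumes "svd_on I s u v (A :: real ^ 'n ^ 'm)"
  shows "card I \<le> min_dim A"
  using orthonormal_on_card_le[of I u] orthonormal_on_card_le[of I v] assms
  by (simp add: svd_on_def min_dim_def)

lemma sum_singleton_mset: "(\<Sum>x\<in>S. {#f x#}) = image_mset f (mset_set S)"
  by (induction S rule: infinite_finite_induct) auto

text \<open>This links characteristic roots to decompositions: completed to a basis, the
  \<open>v i\<close> are eigenvectors of \<open>transpose A ** A\<close> with eigenvalues
  \<open>(s i)\<^sup>2\<close>, and the added vectors lie in the kernel of \<open>A\<close>.\<close>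

lemma svd_on_eigenvalues:
  fixes A :: "real ^ 'n ^ 'm"
  assumes svd: "svd_on I s u v A"
  shows "image_mset sqrt (proots (charpoly (transpose A ** A))) =
    image_mset s (mset_set I) + replicate_mset (CARD('n) - card I) 0"
proof -
  have fin: "finite I" and pos: "\<And>i. i \<in> I \<Longrightarrow> 0 \<le> s i" and ov: "orthonormal_on I v"
    using svd by (auto simp: svd_on_def)
  obtain e :: "'n \<Rightarrow> real ^ 'n" and \<iota> where e: "orthonormal_on UNIV e"
    and inj: "inj_on \<iota> I" and e\<iota>: "\<And>i. i \<in> I \<Longrightarrow> e (\<iota> i) = v i"
    using orthonormal_extension[OF ov] by blast
  define d where "d j = (if j \<in> \<iota> ` I then (s (the_inv_into I \<iota> j))\<^sup>2 else 0)" for j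
  have d\<iota>: "d (\<iota> i) = (s i)\<^sup>2" if "i \<in> I" for i
    using that inj by (simp add: d_def the_inv_into_f_f)
  have eig: "(transpose A ** A) *v e j = d j *\<^sub>R e j" for j
  proof (cases "j \<in> \<iota> ` I")
    case True
    then obtain i where i: "i \<in> I" "j = \<iota> i" by blast
    have "transpose A *v (A *v v i) = (s i)\<^sup>2 *\<^sub>R v i"
      using svd_on_mult_right[OF svd i(1)] svd_on_mult_right[OF svd_on_transpose[OF svd] i(1)]
      by (simp add: matrix_vector_mult_scaleR power2_eq_square)
    then show ?thesis using i e\<iota> d\<iota> by (simp add: matrix_vector_mul_assoc)
  next
    case False
    have "v i \<bullet> e j = 0" if "i \<in> I" for i
      using False that e e\<iota>[OF that] by (auto simp: orthonormal_on_def) (metis imageI)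
    then have "A *v e j = 0"
      using svd by (simp add: svd_on_def sum_outer_mult_vec)
    then show ?thesis using False by (simp add: matrix_vector_mul_assoc[symmetric] d_def)
  qed
  have "proots (charpoly (transpose A ** A)) = image_mset d (mset_set UNIV)"
    unfolding charpoly_eq_prod_eigenvalues[OF e eig]
    by (subst proots_prod) (auto simp: sum_singleton_mset)
  also have "(UNIV :: 'n set) = \<iota> ` I \<union> - \<iota> ` I" by auto
  also have "image_mset d (mset_set (\<iota> ` I \<union> - \<iota> ` I)) =
      image_mset d (mset_set (\<iota> ` I)) + image_mset d (mset_set (- \<iota> ` I))"
    using fin by (subst mset_set_Union) auto
  also have "image_mset d (mset_set (\<iota> ` I)) = image_mset (\<lambda>i. (s i)\<^sup>2) (mset_set I)"
    using d\<iota> fin by (subst image_mset_mset_set[OF inj, symmetric]) (auto simp: image_mset.compositionality intro!: image_mset_cong)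
  also have "image_mset d (mset_set (- \<iota> ` I)) = image_mset (\<lambda>_. 0) (mset_set (- \<iota> ` I))"
    by (intro image_mset_cong) (auto simp: d_def)
  also have "\<dots> = replicate_mset (CARD('n) - card I) 0"
    using fin inj by (simp add: image_mset_const_eq Compl_eq_Diff_UNIV card_Diff_subset card_image)
  finally have "image_mset sqrt (proots (charpoly (transpose A ** A))) =
     image_mset (\<lambda>i. sqrt ((s i)\<^sup>2)) (mset_set I) + replicate_mset (CARD('n) - card I) 0"
    by (simp add: image_mset.compositionality comp_def)
  also have "image_mset (\<lambda>i. sqrt ((s i)\<^sup>2)) (mset_set I) = image_mset s (mset_set I)"
    using fin pos by (intro image_mset_cong) auto
  finally show ?thesis .
qed

lemma sorted_list_of_multiset_plus_replicate:
  assumes "\<And>x. x \<in># M \<Longrightarrow> 0 \<le> (x :: real)"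
  shows "sorted_list_of_multiset (M + replicate_mset k 0) =
    replicate k 0 @ sorted_list_of_multiset M"
proof -
  have "sorted (replicate k 0 @ sorted_list_of_multiset M)"
    using assms by (auto simp: sorted_append)
  then have "sort (replicate k 0 @ sorted_list_of_multiset M) = replicate k 0 @ sorted_list_of_multiset M"
    by (simp add: sorted_sort_id)
  then show ?thesis
    by (metis add.commute mset_append mset_replicate mset_sorted_list_of_multiset sorted_list_of_multiset_mset)
qed

lemma svd_on_singular_values:
  fixes A :: "real ^ 'n ^ 'm"
  assumes svd: "svd_on I s u v A"
  shows "singular_values A = rev (sorted_list_of_multiset (image_mset s (mset_set I))) @
    replicate (min_dim A - card I) 0"
proof -
  have fin: "finite I" and pos: "\<And>i. i \<in> I \<Longrightarrow> 0 \<le> s i" using svd by (auto simp: svd_on_def)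
  have len: "length (sorted_list_of_multiset (image_mset s (mset_set I))) = card I"
    by (metis mset_sorted_list_of_multiset size_image_mset size_mset size_mset_set)
  have le: "min_dim A \<le> CARD('n)" by (simp add: min_dim_def)
  have "singular_values A = take (min_dim A)
     (rev (replicate (CARD('n) - card I) 0 @ sorted_list_of_multiset (image_mset s (mset_set I))))"
    unfolding singular_values_def svd_on_eigenvalues[OF svd] using pos fin
    by (subst sorted_list_of_multiset_plus_replicate) auto
  \<comment> \<open>After reversal the padding zeros come last, and
    \<open>card I \<le> min_dim A\<close> ensures that truncation removes only such zeros.\<close>
  then show ?thesis using svd_on_card_le[OF svd] le len by (simp add: take_replicate)
qed

text \<open>Sums ignore the order of the values and \<open>f 0 = 0\<close> hides the padding zeros,
  so any decomposition, of whatever length, evaluates a spectral function.\<close>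

lemma spectral_fun_svd:
  fixes A :: "real ^ 'n ^ 'm"
  assumes svd: "svd_on I s u v A" and f0: "f 0 = 0"
  shows "spectral_fun f A = (\<Sum>i\<in>I. f (s i))"
proof -
  have fin: "finite I" using svd by (auto simp: svd_on_def)
  have len: "length (singular_values A) = min_dim A"
  proof -
    have "length (sorted_list_of_multiset (image_mset s (mset_set I))) = card I"
      by (metis mset_sorted_list_of_multiset size_image_mset size_mset size_mset_set)
    then show ?thesis using svd_on_card_le[OF svd] by (simp add: svd_on_singular_values[OF svd])
  qed
  have "spectral_fun f A = (\<Sum>j<min_dim A. f (singular_values A ! j))"
    unfolding spectral_fun_def sv_def
    by (rule sum.reindex_bij_witness[where i=Suc and j="\<lambda>j. j - 1"]) auto
  also have "\<dots> = sum_list (map f (singular_values A))"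
    using len by (simp add: sum_list_sum_nth atLeast0LessThan)
  also have "\<dots> = sum_list (map f (sorted_list_of_multiset (image_mset s (mset_set I))))"
    by (simp add: svd_on_singular_values[OF svd] f0 rev_map[symmetric] sum_list_rev sum_list_replicate)
  also have "\<dots> = sum_mset (image_mset f (image_mset s (mset_set I)))"
    by (metis mset_map mset_sorted_list_of_multiset sum_mset_sum_list)
  also have "\<dots> = (\<Sum>i\<in>I. f (s i))"
    by (simp add: sum_unfold_sum_mset image_mset.compositionality comp_def)
  finally show ?thesis .
qed

lemma svd_on_le_op_norm:
  fixes A :: "real ^ 'n ^ 'm"
  assumes svd: "svd_on I s u v A" and i: "i \<in> I"
  shows "s i \<le> op_norm A"
proof -
  have fin: "finite I" using svd by (auto simp: svd_on_def)
  define L where "L = sorted_list_of_multiset (image_mset s (mset_set I))"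
  have "s i \<in> set L" using fin i by (simp add: L_def)
  then obtain k where k: "k < length L" "L ! k = s i" by (auto simp: in_set_conv_nth)
  then have ne: "L \<noteq> []" by auto
  have "op_norm A = hd (singular_values A)"
    using ne by (simp add: op_norm_def sv_def svd_on_singular_values[OF svd] L_def[symmetric] hd_conv_nth)
  also have "\<dots> = last L"
    using ne by (simp add: svd_on_singular_values[OF svd] L_def[symmetric] hd_rev)
  finally have "op_norm A = L ! (length L - 1)" using ne by (simp add: last_conv_nth)
  moreover have "L ! k \<le> L ! (length L - 1)"
    using k by (intro sorted_nth_mono) (auto simp: L_def)
  ultimately show ?thesis using k by simp
qed

section \<open>Existence of the decomposition, duality and subgradients\<close>

lemma inner_transpose_mult_vec:
  fixes A :: "real ^ 'n ^ 'm"
  shows "(transpose A *v x) \<bullet> y = x \<bullet> (A *v y)"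
  by (simp add: dot_lmul_matrix transpose_matrix_vector)

text \<open>The equality case of Cauchy-Schwarz: the squared distance from \<open>w\<close> to
  \<open>c *\<^sub>R e\<close> is at most
  \<open>c\<^sup>2 - 2 * c\<^sup>2 + c\<^sup>2\<close>.\<close>

lemma eq_scaleR_of_inner_eq_norm:
  fixes w :: "'a::real_inner"
  assumes "norm e = 1" "e \<bullet> w = c" "norm w \<le> c"
  shows "w = c *\<^sub>R e"
proof -
  have "(norm w)\<^sup>2 \<le> c\<^sup>2" using assms by (intro power_mono) auto
  moreover have "(norm (w - c *\<^sub>R e))\<^sup>2 = (norm w)\<^sup>2 - 2 * c * (e \<bullet> w) + c\<^sup>2 * (norm e)\<^sup>2"
    by (simp only: dot_square_norm[symmetric]) (simp add: inner_diff inner_commute power2_eq_square algebra_simps)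
  ultimately have "(norm (w - c *\<^sub>R e))\<^sup>2 \<le> 0" using assms by (simp add: power2_eq_square)
  then show ?thesis by simp
qed

lemma exists_unit_inner_eq_norm:
  fixes w :: "'a::euclidean_space"
  shows "\<exists>e \<in> sphere 0 1. e \<bullet> w = norm w"
proof (cases "w = 0")
  case True
  obtain e :: 'a where "norm e = 1" using vector_choose_size[of 1] by auto
  then show ?thesis using True by (intro bexI[of _ e]) auto
next
  case False
  then show ?thesis
    by (intro bexI[of _ "w /\<^sub>R norm w"]) (auto simp: dot_square_norm power2_eq_square)
qed

text \<open>The form \<open>u \<bullet> (A *v v)\<close> attains its maximum \<sigma> on the product
  of the unit spheres. At a maximiser neither \<open>A *v v\<close> nor
  \<open>transpose A *v u\<close> is longer than \<sigma>, so
  \<open>eq_scaleR_of_inner_eq_norm\<close> applies to both.\<close>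

lemma top_singular_pair:
  fixes A :: "real ^ 'n ^ 'm"
  assumes "A \<noteq> 0"
  obtains u v \<sigma> where "norm u = 1" "norm v = 1" "0 < \<sigma>" "A *v v = \<sigma> *\<^sub>R u"
    "transpose A *v u = \<sigma> *\<^sub>R v"
proof -
  define h where "h = (\<lambda>z :: (real ^ 'm) \<times> (real ^ 'n). fst z \<bullet> (A *v snd z))"
  define K where "K = sphere (0 :: real ^ 'm) 1 \<times> sphere (0 :: real ^ 'n) 1"
  have "compact K" unfolding K_def by (intro compact_Times compact_sphere)
  moreover have "K \<noteq> {}"
    using exists_unit_inner_eq_norm[of "0 :: real ^ 'm"] exists_unit_inner_eq_norm[of "0 :: real ^ 'n"] by (auto simp: K_def)
  moreover have "continuous_on K h"
    unfolding h_def by (intro continuous_intros linear_continuous_on_compose[OF _ matrix_vector_mul_linear])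
  ultimately obtain z where z: "z \<in> K" "\<And>z'. z' \<in> K \<Longrightarrow> h z' \<le> h z"
    using continuous_attains_sup[of K h] by blast
  define u v \<sigma> where "u = fst z" and "v = snd z" and "\<sigma> = h z"
  have u: "norm u = 1" and v: "norm v = 1" using z by (auto simp: K_def u_def v_def)
  have max: "a \<bullet> (A *v b) \<le> \<sigma>" if "norm a = 1" "norm b = 1" for a b
    using z(2)[of "(a, b)"] that by (simp add: h_def K_def \<sigma>_def)
  have \<sigma>: "u \<bullet> (A *v v) = \<sigma>" by (simp add: u_def v_def \<sigma>_def h_def)
  have le: "norm (A *v b) \<le> \<sigma>" if "norm b = 1" for b
    using exists_unit_inner_eq_norm[of "A *v b"] max[OF _ that] by (metis mem_sphere_0)
  have "norm (transpose A *v u) \<le> \<sigma>"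
  proof -
    obtain e where e: "norm e = 1" "e \<bullet> (transpose A *v u) = norm (transpose A *v u)"
      using exists_unit_inner_eq_norm[of "transpose A *v u"] by auto
    have "e \<bullet> (transpose A *v u) = u \<bullet> (A *v e)"
      by (metis inner_commute inner_transpose_mult_vec)
    then show ?thesis using e max[OF u] by metis
  qed
  then have "transpose A *v u = \<sigma> *\<^sub>R v"
    using v \<sigma> inner_transpose_mult_vec[of A u v]
    by (intro eq_scaleR_of_inner_eq_norm) (simp_all add: inner_commute del: transpose_matrix_vector)
  moreover have "A *v v = \<sigma> *\<^sub>R u"
    using u \<sigma> le[OF v] by (intro eq_scaleR_of_inner_eq_norm)
  moreover have "0 < \<sigma>"
  proof -
    obtain y where y: "A *v y \<noteq> 0"
      using assms by (metis matrix_eq matrix_vector_mult_0)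
    then have "y \<noteq> 0" by auto
    then have "norm (A *v (y /\<^sub>R norm y)) \<le> \<sigma>" by (intro le) auto
    moreover have "0 < norm (A *v (y /\<^sub>R norm y))"
      using y \<open>y \<noteq> 0\<close> by (simp add: matrix_vector_mult_scaleR)
    ultimately show ?thesis by linarith
  qed
  ultimately show ?thesis using u v that by blast
qed

text \<open>Deflation: subtracting a top singular pair lowers the rank. All values produced are
  positive, and dividing by them gives orthogonality to the removed pair.\<close>

lemma svd_exists:
  fixes A :: "real ^ 'n ^ 'm"
  obtains k :: nat and s u v where "svd_on {..<k} s u v A" "\<And>i. i < k \<Longrightarrow> 0 < s i"
proof -
  have "\<exists>(k::nat) s u v. svd_on {..<k} s u v A \<and> (\<forall>i<k. 0 < s i)"
  \<comment> \<open>The measure is the rank, written as the codimension of the kernel.\<close>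
  proof (induction "CARD('n) - dim {x. A *v x = 0}" arbitrary: A rule: less_induct)
    case less
    show ?case
    proof (cases "A = 0")
      case True
      then have "svd_on {..<0::nat} (\<lambda>_. 0) (\<lambda>_. 0) (\<lambda>_. 0) A"
        by (simp add: svd_on_def orthonormal_on_def)
      then show ?thesis by blast
    next
      case False
      then obtain x y \<sigma> where xy: "norm x = 1" "norm y = 1" "0 < \<sigma>" "A *v y = \<sigma> *\<^sub>R x"
        "transpose A *v x = \<sigma> *\<^sub>R y" by (rule top_singular_pair)
      define A' where "A' = A - \<sigma> *\<^sub>R outer x y"
      have A'v: "A' *v z = A *v z - (\<sigma> * (y \<bullet> z)) *\<^sub>R x" for z
        by (simp add: A'_def matrix_vector_mult_diff_rdistrib scaleR_matrix_vector_assoc[symmetric] outer_mult_vec)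
      have yy: "y \<bullet> y = 1" "x \<bullet> x = 1" using xy by (auto simp: dot_square_norm)
      have A'y: "A' *v y = 0" using xy yy by (simp add: A'v)
      have A'x: "transpose A' *v x = 0"
        using xy yy by (simp add: A'_def transpose_diff transpose_scaleR transpose_outer
            matrix_vector_mult_diff_rdistrib scaleR_matrix_vector_assoc[symmetric] outer_mult_vec)
      \<comment> \<open>Kernel vectors of \<open>A\<close> are orthogonal to \<open>y\<close>, so
        deflation keeps them in the kernel and adds \<open>y\<close>.\<close>
      have "A' *v z = 0" if "A *v z = 0" for z
      proof -
        have "\<sigma> * (y \<bullet> z) = x \<bullet> (A *v z)"
          using inner_transpose_mult_vec[of A x z] xy by simp
        then show ?thesis using that by (simp add: A'v)
      qed
      moreover have "A *v y \<noteq> 0" using xy by auto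
      ultimately have "{z. A *v z = 0} \<subset> {z. A' *v z = 0}" using A'y by blast
      moreover have "subspace {z. M *v z = 0}" for M :: "real ^ 'n ^ 'm"
        by (auto simp: subspace_def matrix_vector_right_distrib matrix_vector_mult_scaleR)
      ultimately have "dim {z. A *v z = 0} < dim {z. A' *v z = 0}"
        by (intro dim_psubset) (metis span_eq_iff)
      moreover have "dim {z. A' *v z = 0} \<le> CARD('n)"
        using dim_subset_UNIV[of "{z. A' *v z = 0}"] by simp
      ultimately obtain k :: nat and s u v where
        svd: "svd_on {..<k} s u v A'" and pos: "\<forall>i<k. 0 < s i"
        using less.hyps[of A'] diff_less_mono2 less_le_trans by blast
      have ux: "u i \<bullet> x = 0" if "i < k" for i
      proof -
        have "s i * (u i \<bullet> x) = (transpose A' *v x) \<bullet> v i"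
          using svd_on_mult_right[OF svd, of i] that
          by (simp add: inner_transpose_mult_vec inner_commute[of "u i"] del: transpose_matrix_vector)
        then show ?thesis using A'x pos that by (auto simp del: transpose_matrix_vector)
      qed
      have vy: "v i \<bullet> y = 0" if "i < k" for i
      proof -
        have "s i * (v i \<bullet> y) = u i \<bullet> (A' *v y)"
          using svd_on_mult_right[OF svd_on_transpose[OF svd], of i] that
          by (simp add: inner_transpose_mult_vec[symmetric] del: transpose_matrix_vector)
        then show ?thesis using A'y pos that by auto
      qed
      have orth: "orthonormal_on {..<Suc k} (w(k := e))"
        if "orthonormal_on {..<k} w" "\<And>i. i < k \<Longrightarrow> w i \<bullet> e = 0" "e \<bullet> e = 1"
        for w :: "nat \<Rightarrow> 'x::real_inner" and e
        using that by (auto simp: orthonormal_on_def less_Suc_eq inner_commute)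
      have "svd_on {..<Suc k} (s(k := \<sigma>)) (u(k := x)) (v(k := y)) A"
        using svd xy yy ux vy A'_def
        by (auto simp: svd_on_def less_Suc_eq lessThan_Suc[symmetric] intro!: orth)
          (simp add: lessThan_Suc algebra_simps)
      moreover have "\<forall>i<Suc k. 0 < (s(k := \<sigma>)) i" using pos xy by (auto simp: less_Suc_eq)
      ultimately show ?thesis by blast
    qed
  qed
  then show ?thesis using that by blast
qed

section \<open>Trace duality and subgradients of spectral functions\<close>

text \<open>The inequality of arithmetic and geometric means, then Bessel for each family. It bounds
  the row and column sums of the coupling weights used below.\<close>

lemma sum_abs_inner_le:
  fixes u :: "'i \<Rightarrow> 'a::real_inner" and v :: "'i \<Rightarrow> 'b::real_inner"
  assumes "finite I" "orthonormal_on I u" "orthonormal_on I v" "x \<bullet> x = 1" "y \<bullet> y = 1"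
  shows "(\<Sum>i\<in>I. \<bar>u i \<bullet> x\<bar> * \<bar>v i \<bullet> y\<bar>) \<le> 1"
proof -
  have "2 * (\<bar>a\<bar> * \<bar>b\<bar>) \<le> a\<^sup>2 + b\<^sup>2" for a b :: real
    using sum_squares_bound[of "\<bar>a\<bar>" "\<bar>b\<bar>"] by simp
  then have "2 * (\<Sum>i\<in>I. \<bar>u i \<bullet> x\<bar> * \<bar>v i \<bullet> y\<bar>) \<le> (\<Sum>i\<in>I. (u i \<bullet> x)\<^sup>2 + (v i \<bullet> y)\<^sup>2)"
    unfolding sum_distrib_left by (intro sum_mono)
  also have "\<dots> \<le> 2" using bessel[of I u x] bessel[of I v y] assms by (simp add: sum.distrib)
  finally show ?thesis by simp
qed

lemma nuclear_norm_eq_spectral_fun: "nuclear_norm A = spectral_fun (\<lambda>x. x) A"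
  by (simp add: nuclear_norm_def spectral_fun_def)

lemma nuclear_norm_svd:
  "svd_on I s u v A \<Longrightarrow> nuclear_norm A = (\<Sum>i\<in>I. s i)"
  by (simp add: nuclear_norm_eq_spectral_fun spectral_fun_svd)

lemma norm_sum_outer:
  assumes "finite I" "orthonormal_on I u" "orthonormal_on I v"
  shows "(norm (\<Sum>i\<in>I. s i *\<^sub>R outer (u i) (v i)))\<^sup>2 = (\<Sum>i\<in>I. (s i)\<^sup>2)"
proof -
  have "orthonormal_on I (\<lambda>i. outer (u i) (v i))"
    using assms by (auto simp: orthonormal_on_def inner_outer_outer)
  from orthonormal_sum_inner[OF assms(1) this] show ?thesis
    by (simp add: dot_square_norm[symmetric] inner_sum_right) (simp add: power2_eq_square)
qed

lemma spectral_fun_power2: "spectral_fun power2 A = (norm A)\<^sup>2"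
proof -
  obtain k :: nat and s u v where "svd_on {..<k} s u v A" by (rule svd_exists)
  then show ?thesis by (subst spectral_fun_svd) (auto simp: svd_on_def norm_sum_outer)
qed

lemma frob_norm_eq_norm: "frob_norm A = norm A"
proof -
  have "frob_norm A = sqrt (spectral_fun power2 A)" by (simp add: frob_norm_def spectral_fun_def)
  then show ?thesis by (simp add: spectral_fun_power2)
qed

text \<open>The inner product expands over pairs of rank-one terms; since \<open>g i * b j\<close>
  is nonnegative, each coefficient may be replaced by its absolute value.\<close>

lemma inner_sum_outer_le_coupling:
  assumes g: "\<And>i. i \<in> I \<Longrightarrow> 0 \<le> g i" and B: "svd_on J b x y B"
  shows "(\<Sum>i\<in>I. g i *\<^sub>R outer (u i) (v i)) \<bullet> B \<le>
    (\<Sum>i\<in>I. \<Sum>j\<in>J. \<bar>u i \<bullet> x j\<bar> * \<bar>v i \<bullet> y j\<bar> * (g i * b j))"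
proof -
  have "(\<Sum>i\<in>I. g i *\<^sub>R outer (u i) (v i)) \<bullet> B =
      (\<Sum>i\<in>I. \<Sum>j\<in>J. ((u i \<bullet> x j) * (v i \<bullet> y j)) * (g i * b j))"
    using B by (simp add: svd_on_def inner_sum_left inner_sum_right inner_outer_outer sum_distrib_left mult_ac)
      (subst sum.swap, simp add: mult_ac)
  also have "\<dots> \<le> (\<Sum>i\<in>I. \<Sum>j\<in>J. \<bar>u i \<bullet> x j\<bar> * \<bar>v i \<bullet> y j\<bar> * (g i * b j))"
    using g B unfolding svd_on_def
    by (intro sum_mono mult_right_mono) (auto simp del: abs_mult simp flip: abs_mult)
  finally show ?thesis .
qed

text \<open>
  With \<open>w\<^sub>i\<^sub>j = |\<langle>u\<^sub>i, x\<^sub>j\<rangle>\<langle>v\<^sub>i, y\<^sub>j\<rangle>|\<close> the matrix \<open>w\<close> is doubly substochastic, so the scalar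
  inequalities \<open>g\<^sub>i b\<^sub>j \<le> f(b\<^sub>j) + (g\<^sub>i a\<^sub>i - f(a\<^sub>i))\<close>, both summands being nonnegative, add up.
\<close>
lemma spectral_fun_subgradient:
  fixes A B :: "real ^ 'n ^ 'm"
  assumes A: "svd_on I a u v A"
    and f: "f 0 = 0" "\<And>t. 0 \<le> t \<Longrightarrow> 0 \<le> f t"
    and g: "\<And>i. i \<in> I \<Longrightarrow> 0 \<le> g i"
    and slope: "\<And>i t. i \<in> I \<Longrightarrow> 0 \<le> t \<Longrightarrow> f (a i) + g i * (t - a i) \<le> f t"
  shows "spectral_fun f A + (\<Sum>i\<in>I. g i *\<^sub>R outer (u i) (v i)) \<bullet> (B - A) \<le> spectral_fun f B"
proof -
  obtain k :: nat and b x y where B: "svd_on {..<k} b x y B" by (rule svd_exists)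
  define G where "G = (\<Sum>i\<in>I. g i *\<^sub>R outer (u i) (v i))"
  define w where "w i j = \<bar>u i \<bullet> x j\<bar> * \<bar>v i \<bullet> y j\<bar>" for i j
  define h where "h i = g i * a i - f (a i)" for i
  have A': "finite I" "\<And>i. i \<in> I \<Longrightarrow> 0 \<le> a i" "orthonormal_on I u" "orthonormal_on I v"
    using A by (auto simp: svd_on_def)
  have B': "\<And>j. j < k \<Longrightarrow> 0 \<le> b j" "orthonormal_on {..<k} x" "orthonormal_on {..<k} y"
    using B by (auto simp: svd_on_def)
  have w0: "0 \<le> w i j" for i j by (simp add: w_def)
  have wi: "(\<Sum>i\<in>I. w i j) \<le> 1" if "j < k" for j
    unfolding w_def using A' B' that by (intro sum_abs_inner_le) (auto simp: orthonormal_on_def)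
  have wj: "(\<Sum>j<k. w i j) \<le> 1" if "i \<in> I" for i
    unfolding w_def using A' B' that
    by (subst (1 2) inner_commute, intro sum_abs_inner_le) (auto simp: orthonormal_on_def)
  have h0: "0 \<le> h i" if "i \<in> I" for i using slope[OF that, of 0] f by (simp add: h_def)
  have "G \<bullet> B \<le> (\<Sum>i\<in>I. \<Sum>j<k. w i j * (g i * b j))"
    unfolding G_def w_def by (rule inner_sum_outer_le_coupling[OF g B])
  also have "\<dots> \<le> (\<Sum>i\<in>I. \<Sum>j<k. w i j * (f (b j) + h i))"
  proof (intro sum_mono mult_left_mono w0)
    show "g i * b j \<le> f (b j) + h i" if "i \<in> I" "j \<in> {..<k}" for i j
      using slope[OF that(1), of "b j"] B' that by (simp add: h_def algebra_simps)
  qed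
  also have "\<dots> = (\<Sum>j<k. (\<Sum>i\<in>I. w i j) * f (b j)) + (\<Sum>i\<in>I. (\<Sum>j<k. w i j) * h i)"
  proof -
    have "(\<Sum>i\<in>I. \<Sum>j<k. w i j * f (b j)) = (\<Sum>j<k. (\<Sum>i\<in>I. w i j) * f (b j))"
      by (subst sum.swap) (simp add: sum_distrib_right)
    then show ?thesis by (simp add: distrib_left sum.distrib sum_distrib_right)
  qed
  also have "\<dots> \<le> (\<Sum>j<k. f (b j)) + (\<Sum>i\<in>I. h i)"
    using wi wj h0 f B' by (intro add_mono sum_mono mult_left_le_one_le sum_nonneg w0) auto
  also have "\<dots> = spectral_fun f B + (\<Sum>i\<in>I. g i * a i) - spectral_fun f A"
    using f by (simp add: spectral_fun_svd[OF A] spectral_fun_svd[OF B] h_def sum_subtractf)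
  also have "(\<Sum>i\<in>I. g i * a i) = G \<bullet> A"
  proof -
    have "u i \<bullet> (A *v v i) = a i" if "i \<in> I" for i
      using svd_on_mult_right[OF A that] A' that by (simp add: orthonormal_on_def)
    then show ?thesis unfolding G_def inner_sum_outer by simp
  qed
  finally show ?thesis unfolding G_def by (simp add: inner_diff_right)
qed

lemma nuclear_norm_nonneg: "0 \<le> nuclear_norm A"
proof -
  obtain k :: nat and s u v where "svd_on {..<k} s u v A" by (rule svd_exists)
  then show ?thesis by (simp add: nuclear_norm_svd) (auto simp: svd_on_def intro: sum_nonneg)
qed

text \<open>One direction of the duality between operator and nuclear norm: each \<open>g i\<close>
  is raised to \<open>c\<close>, and the weights attached to a fixed \<open>b j\<close> sum to at
  most 1.\<close>

lemma inner_sum_outer_le_nuclear_norm: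
  assumes "finite I" "orthonormal_on I u" "orthonormal_on I v"
    and g: "\<And>i. i \<in> I \<Longrightarrow> 0 \<le> g i \<and> g i \<le> c" "0 \<le> c"
  shows "(\<Sum>i\<in>I. g i *\<^sub>R outer (u i) (v i)) \<bullet> B \<le> c * nuclear_norm B"
proof -
  obtain k :: nat and b x y where B: "svd_on {..<k} b x y B" by (rule svd_exists)
  have "(\<Sum>i\<in>I. g i *\<^sub>R outer (u i) (v i)) \<bullet> B \<le>
      (\<Sum>i\<in>I. \<Sum>j<k. \<bar>u i \<bullet> x j\<bar> * \<bar>v i \<bullet> y j\<bar> * (g i * b j))"
    using g by (intro inner_sum_outer_le_coupling[OF _ B]) auto
  also have "\<dots> \<le> (\<Sum>i\<in>I. \<Sum>j<k. \<bar>u i \<bullet> x j\<bar> * \<bar>v i \<bullet> y j\<bar> * (c * b j))"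
    using g B by (intro sum_mono mult_left_mono mult_right_mono) (auto simp: svd_on_def)
  also have "\<dots> = (\<Sum>j<k. (\<Sum>i\<in>I. \<bar>u i \<bullet> x j\<bar> * \<bar>v i \<bullet> y j\<bar>) * (c * b j))"
    by (subst sum.swap) (simp add: sum_distrib_right)
  also have "\<dots> \<le> (\<Sum>j<k. c * b j)"
    using assms B by (intro sum_mono mult_left_le_one_le sum_nonneg sum_abs_inner_le)
      (auto simp: svd_on_def orthonormal_on_def)
  also have "\<dots> = c * nuclear_norm B" by (simp add: nuclear_norm_svd[OF B] sum_distrib_left)
  finally show ?thesis .
qed

text \<open>The empty decomposition of the zero matrix gives no bound on \<open>op_norm\<close>, so
  a one-term decomposition with value 0 is used.\<close>

lemma op_norm_0: "0 \<le> op_norm (0 :: real ^ 'n ^ 'm)"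
proof -
  have "svd_on {()} (\<lambda>_. 0) (\<lambda>_. axis undefined 1) (\<lambda>_. axis undefined 1) (0 :: real ^ 'n ^ 'm)"
    by (simp add: svd_on_def orthonormal_on_def inner_axis_axis)
  from svd_on_le_op_norm[OF this, of "()"] show ?thesis by simp
qed

lemma inner_le_op_norm_nuclear_norm: "A \<bullet> B \<le> op_norm A * nuclear_norm B"
proof -
  obtain k :: nat and s u v where A: "svd_on {..<k} s u v A" by (rule svd_exists)
  show ?thesis
  proof (cases "k = 0")
    case True
    then have "A = 0" using A by (simp add: svd_on_def)
    then show ?thesis by (simp add: nuclear_norm_nonneg op_norm_0)
  next
    case False
    then have "0 \<le> s 0" "s 0 \<le> op_norm A"
      using A svd_on_le_op_norm[OF A, of 0] by (auto simp: svd_on_def)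
    then have "(\<Sum>i<k. s i *\<^sub>R outer (u i) (v i)) \<bullet> B \<le> op_norm A * nuclear_norm B"
      using A svd_on_le_op_norm[OF A]
      by (intro inner_sum_outer_le_nuclear_norm) (auto simp: svd_on_def)
    then show ?thesis using A by (simp add: svd_on_def)
  qed
qed

text \<open>The matrix with the singular vectors of \<open>A + B\<close> and all values 1 pairs with
  \<open>A + B\<close> to its nuclear norm, and with each summand to at most that summand's nuclear
  norm.\<close>

lemma nuclear_norm_triangle: "nuclear_norm (A + B) \<le> nuclear_norm A + nuclear_norm B"
proof -
  obtain k :: nat and s u v where C: "svd_on {..<k} s u v (A + B)" by (rule svd_exists)
  define G where "G = (\<Sum>i<k. 1 *\<^sub>R outer (u i) (v i))"
  have "G \<bullet> (A + B) = (\<Sum>i<k. 1 * (u i \<bullet> ((A + B) *v v i)))"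
    unfolding G_def by (rule inner_sum_outer)
  also have "\<dots> = nuclear_norm (A + B)"
    unfolding nuclear_norm_svd[OF C]
    using svd_on_mult_right[OF C] C by (intro sum.cong) (simp_all add: svd_on_def orthonormal_on_def)
  finally have "nuclear_norm (A + B) = G \<bullet> A + G \<bullet> B" by (simp add: inner_add_right)
  moreover have "G \<bullet> M \<le> 1 * nuclear_norm M" for M
    unfolding G_def using C by (intro inner_sum_outer_le_nuclear_norm) (auto simp: svd_on_def)
  ultimately show ?thesis by (metis add_mono mult_1)
qed

lemma svd_on_scaleR: "svd_on I s u v A \<Longrightarrow> 0 \<le> c \<Longrightarrow> svd_on I (\<lambda>i. c * s i) u v (c *\<^sub>R A)"
  by (auto simp: svd_on_def scaleR_sum_right)

lemma nuclear_norm_scaleR: "0 \<le> c \<Longrightarrow> nuclear_norm (c *\<^sub>R A) = c * nuclear_norm A"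
proof -
  assume c: "0 \<le> c"
  obtain k :: nat and s u v where A: "svd_on {..<k} s u v A" by (rule svd_exists)
  show ?thesis
    by (simp add: nuclear_norm_svd[OF A] nuclear_norm_svd[OF svd_on_scaleR[OF A c]] sum_distrib_left)
qed

lemma nuclear_norm_minus: "nuclear_norm (- A) = nuclear_norm A"
proof -
  obtain k :: nat and s u v where A: "svd_on {..<k} s u v A" by (rule svd_exists)
  \<comment> \<open>The values must stay nonnegative, so the sign moves into the left
    vectors.\<close>
  then have "svd_on {..<k} s (\<lambda>i. - u i) v (- A)"
    by (auto simp: svd_on_def orthonormal_on_def outer_def vec_eq_iff sum_negf)
  then show ?thesis using A by (simp add: nuclear_norm_svd)
qed

lemma nuclear_norm_0: "nuclear_norm 0 = 0"
  using nuclear_norm_scaleR[of 0 0] by simp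

lemma nuclear_norm_sum_le:
  "nuclear_norm (sum F I) \<le> (\<Sum>i\<in>I. nuclear_norm (F i))"
proof (induction I rule: infinite_finite_induct)
  case (insert i I)
  then show ?case using nuclear_norm_triangle[of "F i" "sum F I"] by simp
qed (simp_all add: nuclear_norm_0)

lemma nuclear_norm_outer: "nuclear_norm (outer u v) = norm u * norm v"
proof (cases "u = 0 \<or> v = 0")
  case True
  then have "outer u v = 0" by (auto simp: outer_def vec_eq_iff)
  then show ?thesis using True by (auto simp: nuclear_norm_0)
next
  case False
  then have "norm u \<noteq> 0" "norm v \<noteq> 0" by auto
  then have "outer u v = (norm u * norm v) *\<^sub>R outer (u /\<^sub>R norm u) (v /\<^sub>R norm v)"
    by (simp only: outer_def vec_eq_iff) (simp add: field_simps)
  then have "svd_on {()} (\<lambda>_. norm u * norm v) (\<lambda>_. u /\<^sub>R norm u) (\<lambda>_. v /\<^sub>R norm v) (outer u v)"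
    using False by (simp add: svd_on_def orthonormal_on_def dot_square_norm power2_eq_square)
  then show ?thesis by (simp add: nuclear_norm_svd)
qed

section \<open>The regularizer\<close>

lemma smooth_part_has_derivative:
  assumes "regularizer_conditions lam \<mu> p"
  shows "(smooth_part lam p has_real_derivative deriv (smooth_part lam p) t) (at t)"
  using assms by (simp add: regularizer_conditions_def DERIV_deriv_iff_real_differentiable)

lemma smooth_part_0:
  assumes "regularizer_conditions lam \<mu> p"
  shows "smooth_part lam p 0 = 0"
  using assms by (simp add: regularizer_conditions_def smooth_part_def)

text \<open>Condition (i) makes the smooth part even, so its derivative at 0 equals its own
  negative.\<close>

lemma deriv_smooth_part_0:
  assumes "regularizer_conditions lam \<mu> p"
  shows "deriv (smooth_part lam p) 0 = 0"
proof -
  let ?q = "smooth_part lam p"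
  have even: "?q (- t) = ?q t" for t
    using assms by (simp add: regularizer_conditions_def smooth_part_def)
  have D: "(?q has_real_derivative deriv ?q 0) (at 0)" by (rule smooth_part_has_derivative[OF assms])
  then have "((\<lambda>t. ?q (- t)) has_real_derivative - deriv ?q 0) (at 0)"
    using DERIV_mirror[of ?q "deriv ?q 0" 0] by simp
  then have "(?q has_real_derivative - deriv ?q 0) (at 0)" by (simp add: even)
  from DERIV_unique[OF D this] show ?thesis by simp
qed

text \<open>By condition (v) the derivative becomes nondecreasing once \<mu> times the argument is
  added; the resulting convex function lies above its tangents.\<close>

lemma smooth_part_plus_square_tangent:
  assumes "regularizer_conditions lam \<mu> p"
  shows "smooth_part lam p a + \<mu> / 2 * a\<^sup>2 + (deriv (smooth_part lam p) a + \<mu> * a) * (t - a)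
    \<le> smooth_part lam p t + \<mu> / 2 * t\<^sup>2"
proof -
  let ?q = "smooth_part lam p"
  define f where "f t = ?q t + \<mu> / 2 * t\<^sup>2" for t
  have D: "(f has_real_derivative deriv ?q t + \<mu> * t) (at t)" for t
    unfolding f_def
    by (auto intro!: derivative_eq_intros smooth_part_has_derivative[OF assms])
  have mono: "deriv ?q x + \<mu> * x \<le> deriv ?q y + \<mu> * y" if "x \<le> y" for x y
  proof (cases "x = y")
    case False
    then have "deriv ?q y - deriv ?q x \<ge> - \<mu> * (y - x)"
      using assms that unfolding regularizer_conditions_def by (metis order_le_less)
    then show ?thesis by (simp add: algebra_simps)
  qed simp
  have "convex_on UNIV f" by (rule convex_on_realI[OF _ D mono]) auto
  from convex_on_imp_above_tangent[OF this, of a t "deriv ?q a + \<mu> * a"] D[of a]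
  show ?thesis by (simp add: f_def)
qed

lemma smooth_part_tangent_above:
  assumes "regularizer_conditions lam \<mu> p"
  shows "smooth_part lam p t \<le> smooth_part lam p a + deriv (smooth_part lam p) a * (t - a)"
proof -
  let ?q = "smooth_part lam p"
  have "convex_on UNIV (\<lambda>t. - ?q t)"
    using assms by (simp add: regularizer_conditions_def concave_on_def)
  from convex_on_imp_above_tangent[OF this, of a t "- deriv ?q a"]
  show ?thesis using DERIV_minus[OF smooth_part_has_derivative[OF assms, of a]] by simp
qed

lemma smooth_part_nonpos:
  assumes "regularizer_conditions lam \<mu> p"
  shows "smooth_part lam p t \<le> 0"
  using smooth_part_tangent_above[OF assms, of t 0]
  by (simp add: smooth_part_0[OF assms] deriv_smooth_part_0[OF assms])

lemma smooth_part_plus_square_nonneg: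
  assumes "regularizer_conditions lam \<mu> p"
  shows "0 \<le> smooth_part lam p t + \<mu> / 2 * t\<^sup>2"
  using smooth_part_plus_square_tangent[OF assms, of 0 t]
  by (simp add: smooth_part_0[OF assms] deriv_smooth_part_0[OF assms])

text \<open>Let \<open>q\<close> be the smooth part. By concavity its tangent at \<open>a\<close>,
  evaluated at 0, lies above \<open>q 0 = 0\<close>, so \<open>a\<close> times the slope is at most
  \<open>q a\<close>, which is nonpositive.\<close>

lemma deriv_smooth_part_nonpos:
  assumes "regularizer_conditions lam \<mu> p" "0 \<le> a"
  shows "deriv (smooth_part lam p) a \<le> 0"
proof (cases "a = 0")
  case False
  have "a * deriv (smooth_part lam p) a \<le> smooth_part lam p a"
    using smooth_part_tangent_above[OF assms(1), of 0 a] smooth_part_0[OF assms(1)]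
    by (simp add: algebra_simps)
  then have "a * deriv (smooth_part lam p) a \<le> 0"
    using smooth_part_nonpos[OF assms(1), of a] by linarith
  then show ?thesis using False assms(2) by (simp add: mult_le_0_iff)
qed (simp add: deriv_smooth_part_0[OF assms(1)])

text \<open>For positive \<open>a\<close> this is the slope of the nondecreasing function
  \<open>p\<close>. Together with \<open>deriv_smooth_part_nonpos\<close> it places the slopes of
  the regularizer in \<open>[0, lam]\<close>.\<close>

lemma deriv_smooth_part_ge:
  assumes "regularizer_conditions lam \<mu> p" "0 \<le> a" "0 < lam"
  shows "0 \<le> deriv (smooth_part lam p) a + lam"
proof (cases "a = 0")
  case False
  then have a: "0 < a" using assms by simp
  let ?h = "\<lambda>t. smooth_part lam p t + lam * t"
  have D: "(?h has_real_derivative deriv (smooth_part lam p) a + lam) (at a)"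
    by (auto intro!: derivative_eq_intros smooth_part_has_derivative[OF assms(1)])
  show ?thesis
  proof (rule ccontr)
    assume "\<not> ?thesis"
    then obtain d where d: "0 < d" "\<And>h. 0 < h \<Longrightarrow> h < d \<Longrightarrow> ?h (a + h) < ?h a"
      using DERIV_neg_dec_right[OF D] by auto
    have "mono_on {0..} p" using assms(1) by (simp add: regularizer_conditions_def)
    then have "p a \<le> p (a + d / 2)" using a d by (auto simp: mono_on_def)
    then show False using d(2)[of "d / 2"] a d(1) by (simp add: smooth_part_def)
  qed
qed (use assms deriv_smooth_part_0[OF assms(1)] in simp)

section \<open>From the scalar conditions to spectral functions\<close>

lemma spectral_fun_regularizer:
  assumes "regularizer_conditions lam \<mu> p"
  shows "spectral_fun p A = spectral_fun (smooth_part lam p) A + lam * nuclear_norm A"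
proof -
  obtain k :: nat and s u v where A: "svd_on {..<k} s u v A" by (rule svd_exists)
  have "p 0 = 0" using assms by (simp add: regularizer_conditions_def)
  moreover have "(\<Sum>i<k. p (s i)) = (\<Sum>i<k. smooth_part lam p (s i) + lam * s i)"
    using A by (intro sum.cong) (auto simp: smooth_part_def svd_on_def)
  ultimately show ?thesis
    by (simp add: spectral_fun_svd[OF A] nuclear_norm_svd[OF A] smooth_part_0[OF assms]
        sum.distrib sum_distrib_left)
qed

lemma spectral_fun_plus_square:
  assumes "f 0 = 0"
  shows "spectral_fun (\<lambda>t. f t + c * t\<^sup>2) A = spectral_fun f A + c * (norm A)\<^sup>2"
proof -
  obtain k :: nat and s u v where A: "svd_on {..<k} s u v A" by (rule svd_exists)
  show ?thesis
    by (simp add: spectral_fun_power2[symmetric] spectral_fun_svd[OF A] assms sum.distrib sum_distrib_left)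
qed

text \<open>The function \<open>F X - K \<bullet> X\<close> has a minimum at \<open>A\<close>, so
  its derivative there vanishes.\<close>

lemma subgradient_eq_gradient:
  assumes "\<And>X. F A + K \<bullet> (X - A) \<le> F X" "GDERIV F A :> E"
  shows "K = E"
proof -
  have "((\<lambda>X. F X - K \<bullet> X) has_derivative (\<lambda>h. h \<bullet> E - K \<bullet> h)) (at A)"
    using assms(2) unfolding gderiv_def by (auto intro!: derivative_eq_intros)
  moreover have "F A - K \<bullet> A \<le> F X - K \<bullet> X" for X
    using assms(1)[of X] by (simp add: inner_diff_right)
  ultimately have "(\<lambda>h. h \<bullet> E - K \<bullet> h) = (\<lambda>h. 0)"
    using differential_zero_maxmin[of A UNIV] by blast
  then have "(E - K) \<bullet> (E - K) = 0"
    by (metis inner_commute inner_diff_right)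
  then show ?thesis by simp
qed

lemma norm_diff_square: "(norm (B - A))\<^sup>2 = (norm B)\<^sup>2 - 2 * (A \<bullet> (B - A)) - (norm A)\<^sup>2"
  for A B :: "'a::real_inner"
  by (simp only: dot_square_norm[symmetric]) (simp add: inner_diff inner_commute)

text \<open>
  After adding \<open>\<mu>/2\<close> times the squared norm the function has a subgradient everywhere, and
  at a point of differentiability that subgradient is the gradient.
\<close>
lemma smooth_part_gradient_lower_bound:
  fixes A B :: "real ^ 'n ^ 'm"
  assumes reg: "regularizer_conditions lam \<mu> p"
    and D: "GDERIV (spectral_fun (smooth_part lam p)) A :> D"
  shows "spectral_fun (smooth_part lam p) A + D \<bullet> (B - A) - \<mu> / 2 * (norm (B - A))\<^sup>2
    \<le> spectral_fun (smooth_part lam p) B"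
proof -
  let ?q = "smooth_part lam p"
  define F where "F X = spectral_fun ?q X + \<mu> / 2 * (norm X)\<^sup>2" for X :: "real ^ 'n ^ 'm"
  have F: "F = spectral_fun (\<lambda>t. ?q t + \<mu> / 2 * t\<^sup>2)"
    by (intro ext) (simp only: F_def spectral_fun_plus_square[of ?q, OF smooth_part_0[OF reg]])
  obtain k :: nat and s u v where A: "svd_on {..<k} s u v A" by (rule svd_exists)
  define K where "K = (\<Sum>i<k. (deriv ?q (s i) + \<mu> * s i) *\<^sub>R outer (u i) (v i))"
  have K: "F A + K \<bullet> (X - A) \<le> F X" for X
    unfolding F K_def
  proof (rule spectral_fun_subgradient[OF A])
    show "0 \<le> deriv ?q (s i) + \<mu> * s i" if "i \<in> {..<k}" for i
    proof -
      have "0 \<le> s i" using A that by (simp add: svd_on_def)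
      moreover have "deriv ?q t - deriv ?q t' \<ge> - \<mu> * (t - t')" if "t' < t" for t t'
        using reg that unfolding regularizer_conditions_def by blast
      ultimately show ?thesis
        using deriv_smooth_part_0[OF reg] by (cases "s i = 0") (force simp: less_le)+
    qed
  qed (use smooth_part_0[OF reg] smooth_part_plus_square_nonneg[OF reg]
       smooth_part_plus_square_tangent[OF reg] in auto)
  have "GDERIV F A :> D + \<mu> *\<^sub>R A"
    using D unfolding gderiv_def F_def dot_square_norm[symmetric]
    by (auto intro!: derivative_eq_intros simp: inner_commute inner_add_right fun_eq_iff)
  then have "K = D + \<mu> *\<^sub>R A" using K by (intro subgradient_eq_gradient) auto
  \<comment> \<open>Completing the square: the quadratic terms and the part
    \<open>\<mu> *\<^sub>R A\<close> of the subgradient combine to \<mu>/2 times the squared norm of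
    \<open>B - A\<close>.\<close>
  then show ?thesis using K[of B] by (simp add: F_def norm_diff_square inner_add_left algebra_simps)
qed

text \<open>A preliminary Lipschitz bound. The convexified regularizer has the subgradient
  \<open>H + \<mu> *\<^sub>R A\<close> at \<open>A\<close>; the values of \<open>H\<close> lie in
  \<open>[0, lam]\<close>, so duality controls its linear term. Subdivision later removes the
  quadratic error.\<close>

lemma regularizer_lower_bound:
  fixes A B :: "real ^ 'n ^ 'm"
  assumes reg: "regularizer_conditions lam \<mu> p" and lam: "0 < lam"
  shows "spectral_fun p A - spectral_fun p B \<le>
    lam * nuclear_norm (B - A) + \<mu> / 2 * (norm (B - A))\<^sup>2"
proof -
  let ?q = "smooth_part lam p"
  \<comment> \<open>On singular values \<open>lam * t\<close> agrees with
    \<open>lam * \<bar>t\<bar>\<close>, and unlike it is differentiable at 0.\<close>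
  define f where "f t = (?q t + lam * t) + \<mu> / 2 * t\<^sup>2" for t
  obtain k :: nat and s u v where A: "svd_on {..<k} s u v A" by (rule svd_exists)
  have s0: "0 \<le> s i" if "i < k" for i using A that by (simp add: svd_on_def)
  have \<mu>: "0 \<le> \<mu>" using reg by (simp add: regularizer_conditions_def)
  have F: "spectral_fun f X = spectral_fun p X + \<mu> / 2 * (norm X)\<^sup>2" for X :: "real ^ 'n ^ 'm"
  proof -
    obtain k :: nat and s u v where X: "svd_on {..<k} s u v X" by (rule svd_exists)
    have "spectral_fun (\<lambda>t. ?q t + lam * t) X = spectral_fun p X"
      unfolding spectral_fun_regularizer[OF reg]
      by (simp add: spectral_fun_svd[OF X] nuclear_norm_svd[OF X] smooth_part_0[OF reg]
          sum.distrib sum_distrib_left)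
    then show ?thesis
      unfolding f_def by (subst spectral_fun_plus_square) (auto simp: smooth_part_0[OF reg])
  qed
  define g where "g i = deriv ?q (s i) + lam" for i
  define H where "H = (\<Sum>i<k. g i *\<^sub>R outer (u i) (v i))"
  have "spectral_fun f A + (\<Sum>i<k. (g i + \<mu> * s i) *\<^sub>R outer (u i) (v i)) \<bullet> (B - A) \<le> spectral_fun f B"
  proof (rule spectral_fun_subgradient[OF A])
    show "f 0 = 0" by (simp add: f_def smooth_part_0[OF reg])
    show "0 \<le> f t" if "0 \<le> t" for t
      using smooth_part_plus_square_nonneg[OF reg, of t] mult_nonneg_nonneg[of lam t] that lam
      unfolding f_def by linarith
    show "0 \<le> g i + \<mu> * s i" if "i \<in> {..<k}" for i
      using deriv_smooth_part_ge[OF reg _ lam, of "s i"] s0 that \<mu> by (simp add: g_def)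
    show "f (s i) + (g i + \<mu> * s i) * (t - s i) \<le> f t" for i t
      using smooth_part_plus_square_tangent[OF reg, of "s i" t] by (simp add: f_def g_def algebra_simps)
  qed
  moreover have "(\<Sum>i<k. (g i + \<mu> * s i) *\<^sub>R outer (u i) (v i)) = H + \<mu> *\<^sub>R A"
    using A by (simp add: svd_on_def H_def scaleR_left_distrib sum.distrib scaleR_sum_right)
  moreover have "H \<bullet> (- (B - A)) \<le> lam * nuclear_norm (- (B - A))"
    unfolding H_def using A lam s0 deriv_smooth_part_ge[OF reg _ lam] deriv_smooth_part_nonpos[OF reg]
    by (intro inner_sum_outer_le_nuclear_norm) (auto simp: svd_on_def g_def)
  ultimately show ?thesis
    unfolding F nuclear_norm_minus by (simp add: norm_diff_square inner_add_left algebra_simps)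
qed

text \<open>Cutting the segment into \<open>n\<close> pieces divides the quadratic error term by \<open>n\<close>.\<close>
lemma regularizer_lipschitz:
  fixes A B :: "real ^ 'n ^ 'm"
  assumes reg: "regularizer_conditions lam \<mu> p" and lam: "0 < lam"
  shows "spectral_fun p A - spectral_fun p B \<le> lam * nuclear_norm (B - A)"
proof -
  define C where "C = B - A"
  define c where "c = \<mu> / 2 * (norm C)\<^sup>2"
  have step: "spectral_fun p A - spectral_fun p B \<le> lam * nuclear_norm C + c / n" if n: "0 < n" for n :: nat
  proof -
    define X where "X j = A + (real j / n) *\<^sub>R C" for j
    have "spectral_fun p (X j) - spectral_fun p (X (Suc j)) \<le> (lam * nuclear_norm C + c / n) / n" for j
    proof -
      have "X (Suc j) - X j = (real (Suc j) / n - real j / n) *\<^sub>R C"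
        by (simp only: X_def scaleR_left_diff_distrib) simp
      also have "real (Suc j) / n - real j / n = 1 / n" using n by (simp add: field_simps)
      finally have d: "X (Suc j) - X j = (1 / n) *\<^sub>R C" .
      have "lam * nuclear_norm (X (Suc j) - X j) + \<mu> / 2 * (norm (X (Suc j) - X j))\<^sup>2 =
          (lam * nuclear_norm C + c / n) / n"
        unfolding d using n by (simp add: nuclear_norm_scaleR c_def power2_eq_square field_simps)
      then show ?thesis using regularizer_lower_bound[OF reg lam, of "X j" "X (Suc j)"] by simp
    qed
    then have "(\<Sum>j<n. spectral_fun p (X j) - spectral_fun p (X (Suc j))) \<le>
        (\<Sum>j<n. (lam * nuclear_norm C + c / n) / n)"
      by (intro sum_mono)
    moreover have "(\<Sum>j<n. spectral_fun p (X j) - spectral_fun p (X (Suc j))) =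
        spectral_fun p (X 0) - spectral_fun p (X n)"
      by (rule sum_lessThan_telescope')
    moreover have "X 0 = A" "X n = B" using n by (auto simp: X_def C_def)
    ultimately show ?thesis using n by simp
  qed
  have "(\<lambda>n. lam * nuclear_norm C + c / real n) \<longlonglongrightarrow> lam * nuclear_norm C + 0"
    by (intro tendsto_intros lim_const_over_n)
  then have "spectral_fun p A - spectral_fun p B \<le> lam * nuclear_norm C + 0"
    by (rule LIMSEQ_le_const) (use step in \<open>auto intro!: exI[of _ 1]\<close>)
  then show ?thesis by (simp add: C_def)
qed

section \<open>Splitting along orthogonal singular subspaces\<close>

lemma svd_on_subset:
  "svd_on I s u v A \<Longrightarrow> J \<subseteq> I \<Longrightarrow> svd_on J s u v (\<Sum>i\<in>J. s i *\<^sub>R outer (u i) (v i))"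
  unfolding svd_on_def by (auto intro: finite_subset orthonormal_on_subset)

lemma nuclear_norm_transpose: "nuclear_norm (transpose A) = nuclear_norm A"
proof -
  obtain k :: nat and s u v where A: "svd_on {..<k} s u v A" by (rule svd_exists)
  then show ?thesis using svd_on_transpose[OF A] by (simp add: nuclear_norm_svd)
qed

lemma norm_transpose_matrix: "norm (transpose A) = norm (A :: real ^ 'n ^ 'm)"
proof -
  obtain k :: nat and s u v where A: "svd_on {..<k} s u v A" by (rule svd_exists)
  have "(norm (transpose A))\<^sup>2 = (norm A)\<^sup>2"
    unfolding spectral_fun_power2[symmetric]
    by (simp add: spectral_fun_svd[OF A] spectral_fun_svd[OF svd_on_transpose[OF A]])
  then show ?thesis by simp
qed

lemma orthonormal_on_Plus:
  assumes "orthonormal_on I x" "orthonormal_on J a" "\<And>i j. i \<in> I \<Longrightarrow> j \<in> J \<Longrightarrow> x i \<bullet> a j = 0"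
  shows "orthonormal_on (I <+> J) (case_sum x a)"
proof -
  have "a j \<bullet> x i = 0" if "i \<in> I" "j \<in> J" for i j
    using assms(3)[OF that] by (simp add: inner_commute)
  then show ?thesis using assms unfolding orthonormal_on_def by (auto split: if_splits) metis+
qed

text \<open>The two kernel conditions make the singular vectors of \<open>B\<close> with positive
  value orthogonal to those of \<open>A\<close>, so the disjoint union of the two decompositions is
  one of \<open>A + B\<close>.\<close>

lemma spectral_fun_add_orthogonal:
  fixes A B :: "real ^ 'n ^ 'm"
  assumes A: "svd_on I s x y A" and f: "f 0 = 0"
    and right: "\<And>i. i \<in> I \<Longrightarrow> B *v y i = 0"
    and left: "\<And>i. i \<in> I \<Longrightarrow> transpose B *v x i = 0"
  shows "spectral_fun f (A + B) = spectral_fun f A + spectral_fun f B"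
proof -
  obtain k :: nat and d a b where B: "svd_on {..<k} d a b B" and d: "\<And>j. j < k \<Longrightarrow> 0 < d j"
    by (rule svd_exists[of B]) blast
  have xa: "x i \<bullet> a j = 0" if "i \<in> I" "j < k" for i j
  proof -
    have "d j * (x i \<bullet> a j) = (transpose B *v x i) \<bullet> b j"
      using svd_on_mult_right[OF B, of j] that
      by (simp add: inner_transpose_mult_vec del: transpose_matrix_vector)
    then show ?thesis
      using left[OF that(1)] d[OF that(2)] by (simp del: transpose_matrix_vector)
  qed
  have yb: "y i \<bullet> b j = 0" if "i \<in> I" "j < k" for i j
  proof -
    have "d j * (b j \<bullet> y i) = a j \<bullet> (B *v y i)"
      using svd_on_mult_right[OF svd_on_transpose[OF B], of j] that
      by (simp add: inner_transpose_mult_vec[symmetric] del: transpose_matrix_vector)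
    then show ?thesis using right[OF that(1)] d[OF that(2)] by (simp add: inner_commute)
  qed
  have AB: "svd_on (I <+> {..<k}) (case_sum s d) (case_sum x a) (case_sum y b) (A + B)"
    using A B xa yb unfolding svd_on_def
    by (auto simp: sum.Plus intro!: orthonormal_on_Plus)
  have "finite I" using A by (simp add: svd_on_def)
  then show ?thesis
    by (simp add: spectral_fun_svd[OF AB] spectral_fun_svd[OF A] spectral_fun_svd[OF B] f sum.Plus)
qed

text \<open>The triangle inequality bounds the left side by the sum of the
  \<open>norm (a i)\<close>, and Cauchy-Schwarz compares it with their sum of squares, which is the
  squared Frobenius norm because the \<open>x i\<close> are orthonormal.\<close>

lemma nuclear_norm_sum_outer_orthonormal:
  fixes x :: "'i \<Rightarrow> real ^ 'm" and a :: "'i \<Rightarrow> real ^ 'n"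
  assumes "finite S" "orthonormal_on S x"
  shows "nuclear_norm (\<Sum>i\<in>S. outer (x i) (a i)) \<le>
    sqrt (card S) * norm (\<Sum>i\<in>S. outer (x i) (a i))"
proof -
  let ?M = "\<Sum>i\<in>S. outer (x i) (a i)"
  have n1: "norm (x i) = 1" if "i \<in> S" for i
    using assms that by (simp add: orthonormal_on_def norm_eq_sqrt_inner)
  have MM: "?M \<bullet> ?M = (\<Sum>i\<in>S. (norm (a i))\<^sup>2)"
  proof -
    have "?M \<bullet> ?M = (\<Sum>i\<in>S. \<Sum>j\<in>S. (x i \<bullet> x j) * (a i \<bullet> a j))"
      by (simp add: inner_sum_left inner_sum_right inner_outer_outer) (rule sum.swap)
    also have "\<dots> = (\<Sum>i\<in>S. \<Sum>j\<in>S. if i = j then a i \<bullet> a j else 0)"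
      using assms by (intro sum.cong) (auto simp: orthonormal_on_def)
    finally show ?thesis using assms by (simp add: dot_square_norm)
  qed
  have "nuclear_norm ?M \<le> (\<Sum>i\<in>S. 1 * norm (a i))"
    using nuclear_norm_sum_le[of "\<lambda>i. outer (x i) (a i)" S] by (simp add: nuclear_norm_outer n1)
  then have "(nuclear_norm ?M)\<^sup>2 \<le> (\<Sum>i\<in>S. 1 * norm (a i))\<^sup>2"
    by (intro power_mono nuclear_norm_nonneg)
  also have "\<dots> \<le> (\<Sum>i\<in>S. 1\<^sup>2) * (\<Sum>i\<in>S. (norm (a i))\<^sup>2)"
    by (rule Cauchy_Schwarz_ineq_sum)
  also have "\<dots> = card S * (norm ?M)\<^sup>2" using MM by (simp add: dot_square_norm)
  finally have "(nuclear_norm ?M)\<^sup>2 \<le> card S * (norm ?M)\<^sup>2" .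
  then have "nuclear_norm ?M \<le> sqrt (card S * (norm ?M)\<^sup>2)" by (rule real_le_rsqrt)
  then show ?thesis by (simp add: real_sqrt_mult)
qed

text \<open>\<open>M1\<close> is \<open>M\<close> multiplied on the left by the orthogonal
  projection onto the span of the \<open>x i\<close>; the second claim is Pythagoras.\<close>

lemma left_projection:
  fixes M :: "real ^ 'n ^ 'm"
  assumes S: "finite S" "orthonormal_on S x"
  defines "M1 \<equiv> (\<Sum>i\<in>S. outer (x i) (transpose M *v x i))"
  shows "nuclear_norm M1 \<le> sqrt (card S) * norm M1"
    and "(norm M)\<^sup>2 = (norm M1)\<^sup>2 + (norm (M - M1))\<^sup>2"
    and "\<And>j. j \<in> S \<Longrightarrow> transpose (M - M1) *v x j = 0"
proof -
  show "nuclear_norm M1 \<le> sqrt (card S) * norm M1"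
    unfolding M1_def by (rule nuclear_norm_sum_outer_orthonormal[OF S])
  show R: "transpose (M - M1) *v x j = 0" if "j \<in> S" for j
  proof -
    have "transpose M1 *v x j = (\<Sum>i\<in>S. (x i \<bullet> x j) *\<^sub>R (transpose M *v x i))"
      by (simp add: M1_def transpose_sum transpose_outer matrix_sum_mult_vec outer_mult_vec del: transpose_matrix_vector)
    also have "\<dots> = (\<Sum>i\<in>S. if i = j then transpose M *v x i else 0)"
      using S that by (intro sum.cong) (auto simp: orthonormal_on_def simp del: transpose_matrix_vector)
    also have "\<dots> = transpose M *v x j" using S that by simp
    finally show ?thesis
      by (simp add: transpose_diff matrix_vector_mult_diff_rdistrib del: transpose_matrix_vector)
  qed
  have "(M - M1) \<bullet> M1 = (\<Sum>i\<in>S. (transpose (M - M1) *v x i) \<bullet> (transpose M *v x i))"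
    unfolding inner_transpose_mult_vec by (subst (2) M1_def) (simp add: inner_sum_right inner_outer_right)
  also have "\<dots> = 0" using R by (simp del: transpose_matrix_vector)
  finally have "(M - M1) \<bullet> M1 = 0" .
  then have "((M - M1) + M1) \<bullet> ((M - M1) + M1) = M1 \<bullet> M1 + (M - M1) \<bullet> (M - M1)"
    by (simp only: inner_add_left inner_add_right inner_commute[of M1 "M - M1"])
  then show "(norm M)\<^sup>2 = (norm M1)\<^sup>2 + (norm (M - M1))\<^sup>2" by (simp add: dot_square_norm)
qed

text \<open>Project away the span of the \<open>x i\<close> on the left, then, by transposing, the
  span of the \<open>y i\<close> on the right. \<open>M2\<close> is the remaining corner and
  \<open>M1\<close> the sum of the two removed pieces.\<close>

lemma corner_decomposition:
  fixes M :: "real ^ 'n ^ 'm"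
  assumes S: "finite S" "orthonormal_on S x" "orthonormal_on S y"
  obtains M1 M2 where "M = M1 + M2" "(norm M)\<^sup>2 \<ge> (norm M2)\<^sup>2"
    "nuclear_norm M1 \<le> sqrt (2 * card S) * norm M"
    "\<And>i. i \<in> S \<Longrightarrow> M2 *v y i = 0" "\<And>i. i \<in> S \<Longrightarrow> transpose M2 *v x i = 0"
proof -
  define P where "P = (\<Sum>i\<in>S. outer (x i) (transpose M *v x i))"
  define R where "R = M - P"
  note P = left_projection[OF S(1,2), where M = M, folded P_def, folded R_def]
  define Q where "Q = (\<Sum>i\<in>S. outer (y i) (transpose (transpose R) *v y i))"
  note Q = left_projection[OF S(1,3), where M = "transpose R", folded Q_def]
  define C where "C = R - transpose Q"
  have C: "transpose R - Q = transpose C" by (simp add: C_def transpose_diff)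
  have nQ: "nuclear_norm (transpose Q) \<le> sqrt (card S) * norm (transpose Q)"
    using Q(1) by (simp add: nuclear_norm_transpose norm_transpose_matrix)
  have nR: "(norm R)\<^sup>2 = (norm (transpose Q))\<^sup>2 + (norm C)\<^sup>2"
    using Q(2) by (simp add: C norm_transpose_matrix)
  have "nuclear_norm (P + transpose Q) \<le> sqrt (card S) * (norm P + norm (transpose Q))"
    using nuclear_norm_triangle[of P "transpose Q"] P(1) nQ by (simp add: algebra_simps)
  \<comment> \<open>The squared norms of the two pieces add up to at most that of \<open>M\<close>,
    hence \<open>sqrt 2\<close> instead of 2.\<close>
  also have "norm P + norm (transpose Q) \<le> sqrt 2 * norm M"
  proof (rule power2_le_imp_le)
    have "(norm P + norm (transpose Q))\<^sup>2 \<le> 2 * ((norm P)\<^sup>2 + (norm (transpose Q))\<^sup>2)"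
      using sum_squares_bound[of "norm P" "norm (transpose Q)"] by (simp add: power2_sum)
    also have "\<dots> \<le> 2 * (norm M)\<^sup>2" using P(2) nR by simp
    finally show "(norm P + norm (transpose Q))\<^sup>2 \<le> (sqrt 2 * norm M)\<^sup>2"
      by (simp add: power_mult_distrib)
  qed simp
  finally have "nuclear_norm (P + transpose Q) \<le> sqrt (2 * card S) * norm M"
    by (simp add: mult_left_mono real_sqrt_mult mult.assoc mult.left_commute)
  moreover have "M = (P + transpose Q) + C" by (simp add: C_def R_def)
  moreover have "(norm M)\<^sup>2 \<ge> (norm C)\<^sup>2" using P(2) nR by simp
  moreover have "C *v y i = 0" if "i \<in> S" for i using Q(3)[OF that] by (simp add: C)
  \<comment> \<open>The second projection preserves what the first achieved: each
    \<open>R *v y j\<close> is already orthogonal to \<open>x i\<close>.\<close>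
  moreover have "transpose C *v x i = 0" if "i \<in> S" for i
  proof -
    have "transpose (transpose Q) *v x i = (\<Sum>j\<in>S. ((R *v y j) \<bullet> x i) *\<^sub>R y j)"
      by (simp add: Q_def matrix_sum_mult_vec outer_mult_vec)
    also have "\<dots> = 0"
    proof (intro sum.neutral ballI)
      fix j
      have "(R *v y j) \<bullet> x i = (transpose R *v x i) \<bullet> y j"
        by (metis inner_commute inner_transpose_mult_vec)
      then show "((R *v y j) \<bullet> x i) *\<^sub>R y j = 0"
        using P(3)[OF that] by (simp del: transpose_matrix_vector)
    qed
    finally show ?thesis
      using P(3)[OF that] by (simp add: C_def transpose_diff matrix_vector_mult_diff_rdistrib del: transpose_matrix_vector)
  qed
  ultimately show ?thesis using that by blast
qed

section \<open>The estimation error\<close>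

text \<open>Since \<open>0 powr 0 = 0\<close> while \<open>t powr 0 = 1\<close> for positive
  \<open>t\<close>, the power formula also counts the nonzero singular values when
  \<open>q = 0\<close>.\<close>

lemma mem_schatten_ball_iff:
  "A \<in> schatten_ball q R \<longleftrightarrow> spectral_fun (\<lambda>t. \<bar>t\<bar> powr q) A \<le> R"
proof (cases "q = 0")
  case True
  have "real (card {j \<in> {1..min_dim A}. sv A j \<noteq> 0}) = (\<Sum>j\<in>{j \<in> {1..min_dim A}. sv A j \<noteq> 0}. 1)"
    by simp
  also have "\<dots> = (\<Sum>j = 1..min_dim A. \<bar>sv A j\<bar> powr 0)"
    by (rule sum.mono_neutral_cong_left) auto
  finally have "real (card {j \<in> {1..min_dim A}. sv A j \<noteq> 0}) = (\<Sum>j = 1..min_dim A. \<bar>sv A j\<bar> powr 0)" .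
  with True show ?thesis by (simp add: schatten_ball_def spectral_fun_def)
next
  case False
  then show ?thesis by (simp add: schatten_ball_def spectral_fun_def)
qed

lemma regularizer_le_nuclear_norm:
  assumes "regularizer_conditions lam \<mu> p"
  shows "spectral_fun p A \<le> lam * nuclear_norm A"
proof -
  obtain k :: nat and s u v where A: "svd_on {..<k} s u v A" by (rule svd_exists)
  have "spectral_fun (smooth_part lam p) A \<le> 0"
    by (subst spectral_fun_svd[OF A])
      (auto simp: smooth_part_0[OF assms] intro!: sum_nonpos smooth_part_nonpos[OF assms])
  then show ?thesis by (simp add: spectral_fun_regularizer[OF assms])
qed

text \<open>Condition (v) keeps the smooth part above
  \<open>- \<mu> / 2 * t\<^sup>2\<close>.\<close>

lemma regularizer_ge_nuclear_norm:
  fixes A :: "real ^ 'n ^ 'm"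
  assumes "regularizer_conditions lam \<mu> p" "0 < lam"
  shows "lam * nuclear_norm A \<le> spectral_fun p A + \<mu> / 2 * (norm A)\<^sup>2"
proof -
  obtain k :: nat and s u v where A: "svd_on {..<k} s u v A" by (rule svd_exists)
  have "0 \<le> spectral_fun (\<lambda>t. smooth_part lam p t + \<mu> / 2 * t\<^sup>2) A"
    by (subst spectral_fun_svd[OF A])
      (auto simp: smooth_part_0[OF assms(1)] intro!: sum_nonneg smooth_part_plus_square_nonneg[OF assms(1), simplified])
  then show ?thesis
    by (simp only: spectral_fun_plus_square[of "smooth_part lam p", OF smooth_part_0[OF assms(1)]] spectral_fun_regularizer[OF assms(1)])
qed

text \<open>Stationarity is tested at the feasible point \<open>\<Theta>s\<close>. The factor 3/4 is
  1/2 from the gradient at \<open>\<Theta>s\<close> plus 1/4 from the tolerance \<tau>.\<close>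

lemma stationary_point_basic_inequality:
  fixes L :: "real ^ 'n ^ 'm \<Rightarrow> real" and gradL :: "real ^ 'n ^ 'm \<Rightarrow> real ^ 'n ^ 'm"
  assumes reg: "regularizer_conditions lam \<mu> p" and lam: "0 < lam" and \<tau>: "0 < \<tau>"
    and feasible: "\<Theta>s \<in> nuclear_ball \<omega>"
    and gradL: "GDERIV L \<Theta>t :> gradL \<Theta>t"
    and rsc: "\<alpha> * (norm (\<Theta>t - \<Theta>s))\<^sup>2 - \<tau> * (nuclear_norm (\<Theta>t - \<Theta>s))\<^sup>2
      \<le> (gradL \<Theta>t - gradL \<Theta>s) \<bullet> (\<Theta>t - \<Theta>s)"
    and op: "lam \<ge> 2 * max (op_norm (gradL \<Theta>s)) (4 * \<omega> * \<tau>)"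
    and stat: "stationary_point L lam p \<omega> \<Theta>t"
  shows "(\<alpha> - \<mu> / 2) * (norm (\<Theta>t - \<Theta>s))\<^sup>2 \<le>
    spectral_fun p \<Theta>s - spectral_fun p \<Theta>t + 3 / 4 * lam * nuclear_norm (\<Theta>t - \<Theta>s)"
proof -
  let ?\<Delta> = "\<Theta>t - \<Theta>s"
  let ?N = "nuclear_norm ?\<Delta>"
  obtain D' D G where D': "GDERIV L \<Theta>t :> D'"
    and D: "GDERIV (spectral_fun (smooth_part lam p)) \<Theta>t :> D"
    and G: "G \<in> nuclear_subdifferential \<Theta>t"
    and stat': "\<And>B. B \<in> nuclear_ball \<omega> \<Longrightarrow> 0 \<le> (D' + (D + lam *\<^sub>R G)) \<bullet> (B - \<Theta>t)"
    and \<Theta>t: "\<Theta>t \<in> nuclear_ball \<omega>"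
    using stat unfolding stationary_point_def regularizer_gradients_def mat_inner_eq_inner by blast
  have "D' = gradL \<Theta>t"
  proof -
    have "(\<lambda>h. h \<bullet> D') = (\<lambda>h. h \<bullet> gradL \<Theta>t)"
      using D' gradL unfolding gderiv_def by (rule has_derivative_unique)
    then have "\<forall>h. h \<bullet> D' = h \<bullet> gradL \<Theta>t" by (simp add: fun_eq_iff)
    then show ?thesis by (simp only: vector_eq_ldot)
  qed
  then have "0 \<le> (gradL \<Theta>t + (D + lam *\<^sub>R G)) \<bullet> (\<Theta>s - \<Theta>t)"
    using stat'[OF feasible] by (simp only:)
  then have "gradL \<Theta>t \<bullet> ?\<Delta> \<le> D \<bullet> (\<Theta>s - \<Theta>t) + lam * (G \<bullet> (\<Theta>s - \<Theta>t))"
    by (simp add: inner_add_left inner_diff_right algebra_simps)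
  also have "lam * (G \<bullet> (\<Theta>s - \<Theta>t)) \<le> lam * (nuclear_norm \<Theta>s - nuclear_norm \<Theta>t)"
    using G lam by (auto simp: nuclear_subdifferential_def mat_inner_eq_inner intro!: mult_left_mono) (smt (verit))
  also have "D \<bullet> (\<Theta>s - \<Theta>t) \<le> spectral_fun (smooth_part lam p) \<Theta>s - spectral_fun (smooth_part lam p) \<Theta>t
      + \<mu> / 2 * (norm ?\<Delta>)\<^sup>2"
    using smooth_part_gradient_lower_bound[OF reg D, of \<Theta>s] by (simp add: norm_minus_commute)
  finally have 1: "gradL \<Theta>t \<bullet> ?\<Delta> \<le> spectral_fun p \<Theta>s - spectral_fun p \<Theta>t + \<mu> / 2 * (norm ?\<Delta>)\<^sup>2"
    by (simp add: spectral_fun_regularizer[OF reg] algebra_simps)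
  have "- (gradL \<Theta>s \<bullet> ?\<Delta>) \<le> op_norm (gradL \<Theta>s) * ?N"
    using inner_le_op_norm_nuclear_norm[of "gradL \<Theta>s" "- ?\<Delta>"] unfolding nuclear_norm_minus by (simp only: inner_minus_right)
  also have "\<dots> \<le> lam / 2 * ?N"
    using op by (intro mult_right_mono nuclear_norm_nonneg) simp
  finally have 2: "- (gradL \<Theta>s \<bullet> ?\<Delta>) \<le> lam / 2 * ?N" .
  \<comment> \<open>Both points are feasible; one factor of the squared nuclear norm is bounded this
    way, and \<open>8 * \<omega> * \<tau> \<le> lam\<close> then gives the 1/4.\<close>
  have "?N \<le> 2 * \<omega>"
    using nuclear_norm_triangle[of \<Theta>t "- \<Theta>s"] feasible \<Theta>t by (simp add: nuclear_norm_minus nuclear_ball_def)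
  then have "\<tau> * ?N \<le> lam / 4"
  proof -
    assume "?N \<le> 2 * \<omega>"
    then have "\<tau> * ?N \<le> \<tau> * (2 * \<omega>)" using \<tau> by (intro mult_left_mono) auto
    moreover have "2 * (4 * \<omega> * \<tau>) \<le> lam" using op by linarith
    ultimately show ?thesis by (simp add: mult_ac)
  qed
  then have "(\<tau> * ?N) * ?N \<le> lam / 4 * ?N" by (intro mult_right_mono nuclear_norm_nonneg)
  then have "\<tau> * ?N\<^sup>2 \<le> lam / 4 * ?N" by (simp add: power2_eq_square)
  then show ?thesis using 1 2 rsc by (simp add: inner_diff_left algebra_simps)
qed

text \<open>Above \<eta> the power \<open>q\<close> is monotone; below it
  \<open>s i powr (q - 1)\<close> is at least \<open>\<eta> powr (q - 1)\<close>, the exponent being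
  nonpositive. Large and small values use disjoint shares of the budget \<open>R\<close>.\<close>

lemma powr_tail_bounds:
  fixes s :: "'i \<Rightarrow> real"
  assumes "finite I" "\<And>i. i \<in> I \<Longrightarrow> 0 < s i" "0 \<le> q" "q \<le> 1" "0 < \<eta>"
    and "(\<Sum>i\<in>I. s i powr q) \<le> R"
  shows "real (card {i \<in> I. \<eta> < s i}) * \<eta> powr q + (\<Sum>i\<in>{i \<in> I. s i \<le> \<eta>}. s i) * \<eta> powr (q - 1) \<le> R"
proof -
  let ?S = "{i \<in> I. \<eta> < s i}" and ?T = "{i \<in> I. s i \<le> \<eta>}"
  have "real (card ?S) * \<eta> powr q = (\<Sum>i\<in>?S. \<eta> powr q)" by simp
  also have "\<dots> \<le> (\<Sum>i\<in>?S. s i powr q)"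
    using assms by (intro sum_mono powr_mono2) auto
  finally have 1: "real (card ?S) * \<eta> powr q \<le> (\<Sum>i\<in>?S. s i powr q)" .
  have "(\<Sum>i\<in>?T. s i) * \<eta> powr (q - 1) \<le> (\<Sum>i\<in>?T. s i powr q)"
    unfolding sum_distrib_right
  proof (intro sum_mono)
    fix i assume i: "i \<in> ?T"
    then have "\<eta> powr (q - 1) \<le> s i powr (q - 1)"
      using assms by (intro powr_mono2') auto
    then have "s i * \<eta> powr (q - 1) \<le> s i powr 1 * s i powr (q - 1)"
      using assms(2)[of i] i by (simp add: mult_left_mono)
    also have "\<dots> = s i powr q" unfolding powr_add[symmetric] by simp
    finally show "s i * \<eta> powr (q - 1) \<le> s i powr q" .
  qed
  moreover have "(\<Sum>i\<in>I. s i powr q) = (\<Sum>i\<in>?S. s i powr q) + (\<Sum>i\<in>?T. s i powr q)"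
    using assms(1) by (subst sum.union_disjoint[symmetric]) (auto intro!: sum.cong)
  ultimately show ?thesis using 1 assms(6) by linarith
qed

text \<open>
  \<open>M\<close> is the nuclear norm of the part of \<open>\<Theta>t - \<Theta>s\<close> orthogonal to the singular vectors in \<open>S\<close>.
  The curvature \<open>\<mu>/2\<close> left over in the last hypothesis absorbs the concavity of the regularizer there.
\<close>
lemma regularizer_decomposition:
  fixes \<Theta>s \<Theta>t :: "real ^ 'n ^ 'm"
  assumes reg: "regularizer_conditions lam \<mu> p" and lam: "0 < lam"
    and svd: "svd_on I s x y \<Theta>s" and S: "S \<subseteq> I"
    and basic: "(\<alpha> - \<mu> / 2) * (norm (\<Theta>t - \<Theta>s))\<^sup>2 \<le>
      spectral_fun p \<Theta>s - spectral_fun p \<Theta>t + 3 / 4 * lam * nuclear_norm (\<Theta>t - \<Theta>s)"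
  obtains M where "M \<ge> 0"
    "(\<alpha> - \<mu>) * (norm (\<Theta>t - \<Theta>s))\<^sup>2 + lam / 4 * M \<le>
      7 / 4 * lam * (sqrt (2 * card S) * norm (\<Theta>t - \<Theta>s)) + 2 * lam * (\<Sum>i\<in>I - S. s i)"
    "nuclear_norm (\<Theta>t - \<Theta>s) \<le> sqrt (2 * card S) * norm (\<Theta>t - \<Theta>s) + M"
proof -
  let ?\<Delta> = "\<Theta>t - \<Theta>s"
  define A where "A = (\<Sum>i\<in>S. s i *\<^sub>R outer (x i) (y i))"
  define T where "T = (\<Sum>i\<in>I - S. s i *\<^sub>R outer (x i) (y i))"
  have \<mu>: "0 \<le> \<mu>" and p0: "p 0 = 0" using reg by (auto simp: regularizer_conditions_def)
  have I: "finite I" "orthonormal_on I x" "orthonormal_on I y" using svd by (auto simp: svd_on_def)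
  have svdA: "svd_on S s x y A" unfolding A_def by (rule svd_on_subset[OF svd S])
  have svdT: "svd_on (I - S) s x y T" unfolding T_def by (rule svd_on_subset[OF svd]) auto
  have \<Theta>s: "\<Theta>s = A + T"
    using svd sum.subset_diff[OF S I(1), of "\<lambda>i. s i *\<^sub>R outer (x i) (y i)"]
    by (simp add: A_def T_def svd_on_def)
  obtain M1 M2 where M: "?\<Delta> = M1 + M2" "(norm M2)\<^sup>2 \<le> (norm ?\<Delta>)\<^sup>2"
    "nuclear_norm M1 \<le> sqrt (2 * card S) * norm ?\<Delta>"
    "\<And>i. i \<in> S \<Longrightarrow> M2 *v y i = 0" "\<And>i. i \<in> S \<Longrightarrow> transpose M2 *v x i = 0"
    using corner_decomposition[of S x y ?\<Delta>] svdA unfolding svd_on_def by blast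
  have "spectral_fun p \<Theta>s = spectral_fun p A + spectral_fun p T"
  proof -
    have "(\<Sum>i\<in>I. p (s i)) = (\<Sum>i\<in>S. p (s i)) + (\<Sum>i\<in>I - S. p (s i))"
      using sum.subset_diff[OF S I(1), of "\<lambda>i. p (s i)"] by simp
    then show ?thesis
      by (simp add: spectral_fun_svd[where f = p, OF svd p0] spectral_fun_svd[where f = p, OF svdA p0] spectral_fun_svd[where f = p, OF svdT p0])
  qed
  moreover have "spectral_fun p (A + M2) = spectral_fun p A + spectral_fun p M2"
    by (rule spectral_fun_add_orthogonal[of S s x y]) (use svdA p0 M in auto)
  \<comment> \<open>The comparison point \<open>A + M2\<close> differs from \<open>\<Theta>t\<close>
    only by \<open>T + M1\<close>.\<close>
  moreover have "spectral_fun p (A + M2) - spectral_fun p \<Theta>t \<le> lam * nuclear_norm (\<Theta>t - (A + M2))"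
    by (rule regularizer_lipschitz[OF reg lam])
  moreover have "lam * nuclear_norm (\<Theta>t - (A + M2)) \<le> lam * (nuclear_norm T + nuclear_norm M1)"
  proof -
    have "\<Theta>t - (A + M2) = T + M1" using M(1) \<Theta>s by (simp add: algebra_simps)
    then show ?thesis using nuclear_norm_triangle[of T M1] lam by simp
  qed
  moreover have "lam * nuclear_norm M2 \<le> spectral_fun p M2 + \<mu> / 2 * (norm M2)\<^sup>2"
    by (rule regularizer_ge_nuclear_norm[OF reg lam])
  moreover have "spectral_fun p T \<le> lam * nuclear_norm T" by (rule regularizer_le_nuclear_norm[OF reg])
  moreover have "\<mu> / 2 * (norm M2)\<^sup>2 \<le> \<mu> / 2 * (norm ?\<Delta>)\<^sup>2" using M(2) \<mu> by (intro mult_left_mono) auto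
  moreover have N: "nuclear_norm ?\<Delta> \<le> nuclear_norm M1 + nuclear_norm M2"
    unfolding M(1) by (rule nuclear_norm_triangle)
  then have "3 / 4 * lam * nuclear_norm ?\<Delta> \<le> 3 / 4 * lam * (nuclear_norm M1 + nuclear_norm M2)"
    using lam by (intro mult_left_mono) auto
  \<comment> \<open>The coefficients of \<open>lam\<close> are 1 + 3/4 for \<open>M1\<close>, 3/4 -
    1 for \<open>M2\<close>, and 1 + 1 for \<open>T\<close>, which enters through its own penalty
    and through the Lipschitz bound.\<close>
  ultimately have "(\<alpha> - \<mu>) * (norm ?\<Delta>)\<^sup>2 + lam / 4 * nuclear_norm M2 \<le>
      7 / 4 * lam * nuclear_norm M1 + 2 * lam * nuclear_norm T"
    using basic by (simp add: algebra_simps)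
  also have "\<dots> \<le> 7 / 4 * lam * (sqrt (2 * card S) * norm ?\<Delta>) + 2 * lam * nuclear_norm T"
    using M(3) lam by (intro add_mono mult_left_mono) auto
  also have "nuclear_norm T = (\<Sum>i\<in>I - S. s i)" by (rule nuclear_norm_svd[OF svdT])
  finally show ?thesis using N M(3) by (intro that[of "nuclear_norm M2"]) (auto simp: nuclear_norm_nonneg)
qed

lemma error_bounds_from_cone:
  fixes x \<eta> q R r t M N lam c :: real
  assumes "0 < lam" "0 < c" "0 \<le> r" "0 \<le> t" "0 \<le> M" "0 \<le> x"
    and \<eta>: "\<eta> = lam / c" "0 \<le> R"
    and main: "c * x\<^sup>2 + lam / 4 * M \<le> 7 / 4 * lam * (sqrt (2 * r) * x) + 2 * lam * t"
    and budget: "r * \<eta> powr q + t * \<eta> powr (q - 1) \<le> R"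
    and N: "N \<le> sqrt (2 * r) * x + M"
  shows "x\<^sup>2 \<le> 9 * R * \<eta> powr (2 - q) \<and> N \<le> (24 * sqrt 2 + 8) * R * \<eta> powr (1 - q)"
proof
  have \<eta>0: "0 < \<eta>" using assms by simp
  have lam: "lam = c * \<eta>" using assms by simp
  have E: "\<eta> powr q * \<eta> powr (2 - q) = \<eta>\<^sup>2" "\<eta> powr (q - 1) * \<eta> powr (2 - q) = \<eta>"
    "\<eta> powr (q - 1) * \<eta> powr (1 - q) = 1" "\<eta> powr q * (\<eta> powr (1 - q))\<^sup>2 = \<eta> powr (2 - q)"
    unfolding power2_eq_square powr_add[symmetric] using \<eta>0 by (simp_all add: power2_eq_square)
  have b1: "r * \<eta> powr q \<le> R" and b2: "t * \<eta> powr (q - 1) \<le> R"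
    using budget mult_nonneg_nonneg[OF \<open>0 \<le> r\<close> powr_ge_zero[of \<eta> q]]
      mult_nonneg_nonneg[OF \<open>0 \<le> t\<close> powr_ge_zero[of \<eta> "q - 1"]] by linarith+
  have "c * x\<^sup>2 \<le> 7 / 4 * lam * (sqrt (2 * r) * x) + 2 * lam * t"
    using main mult_nonneg_nonneg[of lam M] \<open>0 < lam\<close> \<open>0 \<le> M\<close> by linarith
  also have "\<dots> = c * (\<eta> * (7 / 4 * (sqrt (2 * r) * x) + 2 * t))"
    unfolding lam by (simp add: algebra_simps)
  finally have x2: "x\<^sup>2 \<le> \<eta> * (7 / 4 * (sqrt (2 * r) * x) + 2 * t)"
    using \<open>0 < c\<close> by (simp only: mult_le_cancel_left_pos)
  \<comment> \<open>Doubling the previous bound on \<open>x\<^sup>2\<close> produces this cross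
    term, and one \<open>x\<^sup>2\<close> is then absorbed on the left.\<close>
  have "2 * x * (7 / 4 * \<eta> * sqrt (2 * r)) \<le> x\<^sup>2 + (7 / 4 * \<eta> * sqrt (2 * r))\<^sup>2"
    by (rule sum_squares_bound)
  also have "(7 / 4 * \<eta> * sqrt (2 * r))\<^sup>2 = 49 / 8 * (r * \<eta>\<^sup>2)"
    unfolding power_mult_distrib using \<open>0 \<le> r\<close> by (simp add: power_divide)
  finally have "x\<^sup>2 \<le> 49 / 8 * (r * \<eta>\<^sup>2) + 4 * (t * \<eta>)" using x2 by (simp add: algebra_simps)
  \<comment> \<open>Both 49/8 and 4 are below 9, so a common factor lets the joint budget be spent
    once.\<close>
  also have "\<dots> \<le> 9 * (r * \<eta>\<^sup>2) + 9 * (t * \<eta>)" using assms \<eta>0 by (intro add_mono mult_right_mono) auto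
  also have "\<dots> = 9 * ((r * \<eta> powr q + t * \<eta> powr (q - 1)) * \<eta> powr (2 - q))"
    unfolding distrib_right mult.assoc E by simp
  also have "\<dots> \<le> 9 * (R * \<eta> powr (2 - q))"
    using budget by (intro mult_left_mono mult_right_mono) auto
  finally show F: "x\<^sup>2 \<le> 9 * R * \<eta> powr (2 - q)" by simp
  \<comment> \<open>Multiplying the bound on \<open>x\<^sup>2\<close> by \<open>r\<close> and using
    \<open>r * \<eta> powr q \<le> R\<close> yields a perfect square, with 3 as the root of
    9.\<close>
  have "(sqrt r * x)\<^sup>2 = r * x\<^sup>2" using assms by (simp add: power_mult_distrib)
  also have "\<dots> \<le> r * (9 * R * \<eta> powr (2 - q))" using F assms by (intro mult_left_mono) auto
  also have "\<dots> = 9 * R * (r * \<eta> powr q) * (\<eta> powr (1 - q))\<^sup>2"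
    unfolding E(4)[symmetric] by simp
  also have "\<dots> \<le> 9 * R * R * (\<eta> powr (1 - q))\<^sup>2"
    using b1 assms by (intro mult_left_mono mult_right_mono) auto
  also have "\<dots> = (3 * R * \<eta> powr (1 - q))\<^sup>2" by (simp add: power2_eq_square)
  finally have rx: "sqrt r * x \<le> 3 * R * \<eta> powr (1 - q)"
    by (rule power2_le_imp_le) (use assms in auto)
  have t: "t \<le> R * \<eta> powr (1 - q)"
  proof -
    have "t = t * \<eta> powr (q - 1) * \<eta> powr (1 - q)" unfolding mult.assoc E by simp
    also have "\<dots> \<le> R * \<eta> powr (1 - q)" using b2 by (intro mult_right_mono) auto
    finally show ?thesis .
  qed
  have "lam * M \<le> lam * (7 * (sqrt (2 * r) * x) + 8 * t)"
  proof -
    have "0 \<le> c * x\<^sup>2" using \<open>0 < c\<close> by simp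
    then have "lam / 4 * M \<le> 7 / 4 * lam * (sqrt (2 * r) * x) + 2 * lam * t" using main by linarith
    then show ?thesis by (simp add: algebra_simps)
  qed
  then have "M \<le> 7 * (sqrt (2 * r) * x) + 8 * t" using assms by simp
  \<comment> \<open>Here 8 is 1 from the bound on \<open>N\<close> plus 7 from the bound on
    \<open>M\<close>; multiplied by 3 it becomes the 24 of the conclusion.\<close>
  then have "N \<le> 8 * (sqrt 2 * (sqrt r * x)) + 8 * t" using N by (simp add: real_sqrt_mult mult.assoc)
  also have "\<dots> \<le> 8 * (sqrt 2 * (3 * R * \<eta> powr (1 - q))) + 8 * (R * \<eta> powr (1 - q))"
    using rx t by (intro add_mono mult_left_mono) auto
  finally show "N \<le> (24 * sqrt 2 + 8) * R * \<eta> powr (1 - q)" by (simp add: algebra_simps)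
qed

theorem theorem1:
  fixes L :: "real ^ 'n ^ 'm \<Rightarrow> real"
    and gradL :: "real ^ 'n ^ 'm \<Rightarrow> real ^ 'n ^ 'm"
    and \<Theta>s \<Theta>t :: "real ^ 'n ^ 'm"
    and p :: "real \<Rightarrow> real"
    and q R \<omega> lam \<mu> \<alpha> \<tau> :: real
  assumes "0 \<le> q" and "q \<le> 1" and "R > 0" and "\<omega> > 0"
    and "\<Theta>s \<in> schatten_ball q R \<inter> nuclear_ball \<omega>"
    and "lam > 0"
    and "regularizer_conditions lam \<mu> p"
    and "\<And>\<Theta>. L \<Theta> \<ge> 0"
    and "\<And>\<Theta>. GDERIV L \<Theta> :> gradL \<Theta>"
    and "\<alpha> > 0" and "\<tau> > 0" and "\<alpha> > \<mu>"
    and "\<And>\<Delta>. mat_inner (gradL (\<Theta>s + \<Delta>) - gradL \<Theta>s) \<Delta>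
           \<ge> \<alpha> * (frob_norm \<Delta>)\<^sup>2 - \<tau> * (nuclear_norm \<Delta>)\<^sup>2"
    and "lam \<ge> 2 * max (op_norm (gradL \<Theta>s)) (4 * \<omega> * \<tau>)"
    and "stationary_point L lam p \<omega> \<Theta>t"
  shows "(frob_norm (\<Theta>t - \<Theta>s))\<^sup>2 \<le> 9 * R * (lam / (\<alpha> - \<mu>)) powr (2 - q) \<and>
    nuclear_norm (\<Theta>t - \<Theta>s) \<le> (24 * sqrt 2 + 8) * R * (lam / (\<alpha> - \<mu>)) powr (1 - q)"
proof -
  define \<eta> where "\<eta> = lam / (\<alpha> - \<mu>)"
  have \<eta>: "0 < \<eta>" using assms by (simp add: \<eta>_def)
  obtain k :: nat and s x y where svd: "svd_on {..<k} s x y \<Theta>s" and pos: "\<And>i. i < k \<Longrightarrow> 0 < s i"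
    by (rule svd_exists[of \<Theta>s]) blast
  \<comment> \<open>At this level the rank term \<open>(card S) * \<eta>\<^sup>2\<close> and the
    tail term \<open>\<eta>\<close> times the remaining sum scale alike against the budget.\<close>
  define S where "S = {i \<in> {..<k}. \<eta> < s i}"
  have rest: "{i \<in> {..<k}. s i \<le> \<eta>} = {..<k} - S" by (auto simp: S_def)
  have "(\<Sum>i<k. \<bar>s i\<bar> powr q) \<le> R"
    using assms(5) by (simp add: mem_schatten_ball_iff spectral_fun_svd[OF svd])
  also have "(\<Sum>i<k. \<bar>s i\<bar> powr q) = (\<Sum>i<k. s i powr q)"
    using pos by (intro sum.cong) (auto simp: abs_of_pos)
  finally have "(\<Sum>i<k. s i powr q) \<le> R" .
  then have budget: "real (card S) * \<eta> powr q + (\<Sum>i\<in>{..<k} - S. s i) * \<eta> powr (q - 1) \<le> R"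
    unfolding S_def[symmetric] rest[symmetric]
    using powr_tail_bounds[of "{..<k}" s q \<eta> R] pos \<eta> assms(1,2) by (simp add: S_def)
  have "\<alpha> * (norm (\<Theta>t - \<Theta>s))\<^sup>2 - \<tau> * (nuclear_norm (\<Theta>t - \<Theta>s))\<^sup>2
      \<le> (gradL \<Theta>t - gradL \<Theta>s) \<bullet> (\<Theta>t - \<Theta>s)"
    using assms(13)[of "\<Theta>t - \<Theta>s"] by (simp add: mat_inner_eq_inner frob_norm_eq_norm)
  then have basic: "(\<alpha> - \<mu> / 2) * (norm (\<Theta>t - \<Theta>s))\<^sup>2 \<le>
      spectral_fun p \<Theta>s - spectral_fun p \<Theta>t + 3 / 4 * lam * nuclear_norm (\<Theta>t - \<Theta>s)"
    using assms by (intro stationary_point_basic_inequality[where gradL = gradL]) auto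
  obtain M where M: "0 \<le> M"
    "(\<alpha> - \<mu>) * (norm (\<Theta>t - \<Theta>s))\<^sup>2 + lam / 4 * M \<le>
      7 / 4 * lam * (sqrt (2 * card S) * norm (\<Theta>t - \<Theta>s)) + 2 * lam * (\<Sum>i\<in>{..<k} - S. s i)"
    "nuclear_norm (\<Theta>t - \<Theta>s) \<le> sqrt (2 * card S) * norm (\<Theta>t - \<Theta>s) + M"
    by (rule regularizer_decomposition[OF assms(7,6) svd _ basic, of S]) (auto simp: S_def)
  show ?thesis
    unfolding frob_norm_eq_norm \<eta>_def[symmetric]
  proof (rule error_bounds_from_cone[of lam "\<alpha> - \<mu>" "real (card S)" "\<Sum>i\<in>{..<k} - S. s i" M])
    show "0 \<le> (\<Sum>i\<in>{..<k} - S. s i)" using pos by (intro sum_nonneg) (auto intro: less_imp_le)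
  qed (use assms M budget \<eta>_def in auto)
qed

end
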